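(* Let $B_1,\dots,B_m$ be $n\times n$ complex symmetric matrices ($B_r^t=B_r$), $n\ge 2$. Then $$\sum_{r,s=1}^m\|[B_r,B_s]\|^2\le\left(\sum_{r=1}^m\|B_r\|^2\right)^2 .$$ For $1\le r\le m$ let $A_r^1=\frac12(B_r+\overline{B_r})$ and $A_r^2=\frac1{2\mathbf{i}}(B_r-\overline{B_r})$. Equality holds if and only if $\sum_{r=1}^m[B_r,\overline{B_r}]=0$ and there exists $(P,R)\in K(n,2m)$ with $P\in O(n)$ such that $$(P,R)\cdot(A_1^1,\dots,A_m^1,A_1^2,\dots,A_m^2)=(\mathrm{diag}(H_1,0),\mathrm{diag}(H_2,0),0,\dots,0),$$ where for some real $\lambda\ge 0$, $$H_1=\begin{pmatrix}\lambda&0\\0&-\lambda\end{pmatrix},\quad H_2=\begin{pmatrix}0&\lambda\\\lambda&0\end{pmatrix}.$$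
   Context: $[A,B]=AB-BA$; $\overline{A}$ is the entrywise complex conjugate; $A^*=\overline{A}^t$; $\|B\|^2=\mathrm{tr}(BB^* )$ is the squared Frobenius norm; $\mathbf{i}$ is the imaginary unit. $\mathrm{diag}(H,0)$ denotes the $n\times n$ block diagonal matrix with upper-left block $H$ and all other entries zero (the zero block may be empty). For positive integers $n,k$, $K(n,k):=U(n)\times O(k)$ (unitary group times real orthogonal group), acting on $k$-tuples of $n\times n$ matrices by $$(P,R)\cdot(A_1,\dots,A_k):=\left(\sum_{j=1}^kR_{j1}P^*A_jP,\dots,\sum_{j=1}^kR_{jk}P^*A_jP\right),\qquad R=(R_{jl})\in O(k).$$ $O(n)$ is the group of real orthogonal $n\times n$ matrices, regarded as a subgroup of $U(n)$. *)

theory Defs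
  imports "HOL.Complex" "Jordan_Normal_Form.Schur_Decomposition"
begin

abbreviation mat_cnj :: "complex mat \<Rightarrow> complex mat" where
  "mat_cnj A \<equiv> map_mat cnj A"

definition commutator :: "complex mat \<Rightarrow> complex mat \<Rightarrow> complex mat" where
  "commutator A B = A * B - B * A"

definition mat_trace :: "complex mat \<Rightarrow> complex" where
  "mat_trace A = (\<Sum>i<dim_row A. A $$ (i, i))"

text \<open>The trace of \<open>B * mat_adjoint B\<close> is a nonnegative real number; \<open>Re\<close> only changes its type
  (see \<open>frobenius_sq_trace\<close> below).\<close>

definition frobenius_sq :: "complex mat \<Rightarrow> real" where
  "frobenius_sq B = Re (mat_trace (B * mat_adjoint B))"

definition finsum_mat :: "nat \<Rightarrow> ('c \<Rightarrow> complex mat) \<Rightarrow> 'c set \<Rightarrow> complex mat" where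
  "finsum_mat n = finsum (module_mat TYPE(complex) n n)"

definition mat_Re :: "complex mat \<Rightarrow> complex mat" where
  "mat_Re B = (1 / 2) \<cdot>\<^sub>m (B + mat_cnj B)"

definition mat_Im :: "complex mat \<Rightarrow> complex mat" where
  "mat_Im B = (1 / (2 * \<i>)) \<cdot>\<^sub>m (B - mat_cnj B)"

definition unitary_group :: "nat \<Rightarrow> complex mat set" where
  "unitary_group n = {P \<in> carrier_mat n n. mat_adjoint P * P = 1\<^sub>m n}"

text \<open>The predicate \<open>orthogonal_mat\<close> of the matrix library only requires the columns to be
  pairwise orthogonal and nonzero, so it is not usable here.\<close>

definition orthogonal_group :: "nat \<Rightarrow> real mat set" where
  "orthogonal_group k = {Q \<in> carrier_mat k k. transpose_mat Q * Q = 1\<^sub>m k}"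

definition K :: "nat \<Rightarrow> nat \<Rightarrow> (complex mat \<times> real mat) set" where
  "K n k = unitary_group n \<times> orthogonal_group k"

definition K_act :: "complex mat \<times> real mat \<Rightarrow> complex mat list \<Rightarrow> complex mat list" where
  "K_act = (\<lambda>(P, R) As.
     map (\<lambda>l. finsum_mat (dim_row P)
                (\<lambda>j. complex_of_real (R $$ (j, l)) \<cdot>\<^sub>m (mat_adjoint P * As ! j * P))
                {..<length As})
       [0..<length As])"

definition diag_zero :: "nat \<Rightarrow> complex mat \<Rightarrow> complex mat" where
  "diag_zero n H =
     (let h = dim_row H
      in four_block_mat H (0\<^sub>m h (n - h)) (0\<^sub>m (n - h) h) (0\<^sub>m (n - h) (n - h)))"

definition H1 :: "real \<Rightarrow> complex mat" where
  "H1 t = mat_of_rows_list 2 [[complex_of_real t, 0], [0, - complex_of_real t]]"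

definition H2 :: "real \<Rightarrow> complex mat" where
  "H2 t = mat_of_rows_list 2 [[0, complex_of_real t], [complex_of_real t, 0]]"

lemma index_mat_adjoint:
  assumes "i < dim_col A" "j < dim_row A"
  shows "mat_adjoint A $$ (i, j) = cnj (A $$ (j, i))"
  using assms by (simp add: mat_adjoint_def mat_of_rows_index conjugate_vec_def)

lemma mat_adjoint_eq: "mat_adjoint A = transpose_mat (mat_cnj A)"
  by (rule eq_matI) (auto simp: index_mat_adjoint, auto simp: mat_adjoint_def)

lemma frobenius_sq_trace:
  "complex_of_real (frobenius_sq B) = mat_trace (B * mat_adjoint B)"
  "frobenius_sq B = (\<Sum>i<dim_row B. \<Sum>j<dim_col B. (cmod (B $$ (i, j)))\<^sup>2)"
proof -
  have "mat_trace (B * mat_adjoint B) =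
      complex_of_real (\<Sum>i<dim_row B. \<Sum>j<dim_col B. (cmod (B $$ (i, j)))\<^sup>2)"
    by (simp add: mat_trace_def mat_adjoint_eq scalar_prod_def complex_norm_square lessThan_atLeast0
        del: of_real_power)
  then show "complex_of_real (frobenius_sq B) = mat_trace (B * mat_adjoint B)"
    "frobenius_sq B = (\<Sum>i<dim_row B. \<Sum>j<dim_col B. (cmod (B $$ (i, j)))\<^sup>2)"
    by (simp_all add: frobenius_sq_def)
qed

lemma finsum_mat_index:
  assumes "finite S" "\<And>s. s \<in> S \<Longrightarrow> f s \<in> carrier_mat n n"
  shows "finsum_mat n f S = mat n n (\<lambda>(i, j). \<Sum>s\<in>S. f s $$ (i, j))"
proof -
  interpret M: abelian_group "module_mat TYPE(complex) n n"
    by (rule abelian_group_mat)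
  show ?thesis
    using assms
  proof (induction S rule: finite_induct)
    case empty
    then show ?case
      by (auto simp: finsum_mat_def module_mat_simps)
  next
    case (insert x F)
    have "finsum_mat n f (insert x F) = f x + finsum_mat n f F"
      unfolding finsum_mat_def
      using insert by (subst M.finsum_insert) (auto simp: module_mat_simps)
    with insert show ?case
      by (auto intro!: eq_matI)
  qed
qed

end

theory Submission
  imports Defs "Jordan_Normal_Form.Spectral_Radius"
begin

text \<open>Writing \<open>B r = X r + \<i> Y r\<close> with real symmetric \<open>X r\<close>, \<open>Y r\<close>, the Jacobi identity shows that
  the left-hand side is the corresponding sum for the \<open>2 m\<close> real symmetric matrices \<open>X r\<close>, \<open>Y r\<close>,
  diminished by twice the squared norm of the sum of all \<open>[X r, Y r]\<close>. This reduces everything to the DDVV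
  inequality for real symmetric matrices and its equality case.

  There, diagonalising the Gram matrix makes the family orthogonal, so that it consists of multiples of
  orthonormal matrices \<open>E i\<close>, and the claim says that a quadratic form in the squared lengths with
  coefficients \<open>c i j = \<parallel>[E i, E j]\<parallel>\<^sup>2\<close> is at most the square of their sum. Peeling off the
  smallest length inductively, it suffices that \<open>c i j\<close> summed over \<open>j \<in> T\<close> is at most \<open>card T\<close>
  whenever \<open>i \<in> T\<close>. In an eigenbasis of \<open>E i\<close> that sum is the energy of the spectrum of \<open>E i\<close> on a weighted
  graph with weights in \<open>[0, 1]\<close> of total \<open>card T - 1\<close> (Bessel), and a graph Laplacian with such
  weights has norm at most its total weight plus one, because the degrees of two distinct vertices
  add up to at most that.

  Equality forces the graph to be a star. If it has more than one edge, then \<open>E i\<close> has a nonzero trace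
  of the cube while all other \<open>E j\<close> have a vanishing one; as this holds for every \<open>i\<close>, only two matrices
  can survive, and the single edge gives their normal form.\<close>

section \<open>The real spectral theorem\<close>

lemma orthogonal_group_carrier: "Q \<in> orthogonal_group n \<Longrightarrow> Q \<in> carrier_mat n n"
  by (simp add: orthogonal_group_def)

lemma orthogonal_group_transpose_mult: "Q \<in> orthogonal_group n \<Longrightarrow> transpose_mat Q * Q = 1\<^sub>m n"
  by (simp add: orthogonal_group_def)

lemma orthogonal_group_mult_transpose:
  assumes "Q \<in> orthogonal_group n"
  shows "Q * transpose_mat Q = 1\<^sub>m n"
  using assms by (intro mat_mult_left_right_inverse[of "transpose_mat Q"]) (auto simp: orthogonal_group_def)

lemma orthogonal_groupI:
  assumes "Q \<in> carrier_mat n n"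
    and "\<And>i j. i < n \<Longrightarrow> j < n \<Longrightarrow> (\<Sum>x<n. Q $$ (x, i) * Q $$ (x, j)) = (if i = j then 1 else 0)"
  shows "Q \<in> orthogonal_group n"
  using assms unfolding orthogonal_group_def
  by (auto intro!: eq_matI simp: scalar_prod_def lessThan_atLeast0)

lemma orthogonal_group_cols:
  assumes "Q \<in> orthogonal_group n" "i < n" "j < n"
  shows "(\<Sum>x<n. Q $$ (x, i) * Q $$ (x, j)) = (if i = j then 1 else 0)"
proof -
  have "(transpose_mat Q * Q) $$ (i, j) = (if i = j then 1 else 0)"
    using assms by (simp add: orthogonal_group_transpose_mult)
  then show ?thesis
    using assms orthogonal_group_carrier[OF assms(1)]
    by (simp add: scalar_prod_def lessThan_atLeast0)
qed

lemma orthogonal_group_rows: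
  assumes "Q \<in> orthogonal_group n" "i < n" "j < n"
  shows "(\<Sum>x<n. Q $$ (i, x) * Q $$ (j, x)) = (if i = j then 1 else 0)"
proof -
  have "(Q * transpose_mat Q) $$ (i, j) = (if i = j then 1 else 0)"
    using assms by (simp add: orthogonal_group_mult_transpose)
  then show ?thesis
    using assms orthogonal_group_carrier[OF assms(1)]
    by (simp add: scalar_prod_def lessThan_atLeast0)
qed

lemma one_mem_orthogonal_group: "1\<^sub>m n \<in> orthogonal_group n"
  by (simp add: orthogonal_group_def)

lemma mult_mem_orthogonal_group:
  assumes P: "P \<in> orthogonal_group n" and Q: "Q \<in> orthogonal_group n"
  shows "P * Q \<in> orthogonal_group n"
proof -
  note [simp] = orthogonal_group_carrier[OF P] orthogonal_group_carrier[OF Q]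
    mult_carrier_mat[OF orthogonal_group_carrier[OF P] orthogonal_group_carrier[OF Q]]
  have "transpose_mat (P * Q) * (P * Q) = transpose_mat Q * (transpose_mat P * (P * Q))"
    by (subst transpose_mult[of _ n n _ n], simp, simp, rule assoc_mult_mat[of _ n n _ n _ n]) auto
  also have "transpose_mat P * (P * Q) = (transpose_mat P * P) * Q"
    by (rule assoc_mult_mat[symmetric, of _ n n _ n _ n]) auto
  also have "\<dots> = Q"
    using P by (simp add: orthogonal_group_transpose_mult left_mult_one_mat[of _ n n])
  finally show ?thesis
    using Q by (simp add: orthogonal_group_def)
qed

lemma sum_if_eq_mult:
  fixes f :: "nat \<Rightarrow> 'a :: comm_ring_1"
  shows "i < n \<Longrightarrow> (\<Sum>x<n. (if x = i then 1 else 0) * f x) = f i"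
    and "i < n \<Longrightarrow> (\<Sum>x<n. f x * (if x = i then 1 else 0)) = f i"
  by (simp_all add: if_distrib[of "\<lambda>z. z * _"] if_distrib[of "(*) _"] cong: if_cong)

text \<open>The Householder reflection exchanging a unit vector with the first standard basis vector.\<close>

lemma orthogonal_group_first_col:
  fixes v :: "nat \<Rightarrow> real"
  assumes n: "n > 0" and v: "(\<Sum>i<n. (v i)\<^sup>2) = 1"
  obtains U where "U \<in> orthogonal_group n" "\<And>i. i < n \<Longrightarrow> U $$ (i, 0) = v i"
proof -
  \<comment> \<open>The normal of the reflecting hyperplane is \<open>v\<close> minus the first
    basis vector, and \<open>s\<close> is its squared length.\<close>
  define w where "w i = v i - (if i = 0 then 1 else 0)" for i
  define s where "s = (\<Sum>i<n. (w i)\<^sup>2)"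
  have "s = (\<Sum>i<n. (v i)\<^sup>2 + ((if i = 0 then 1 else 0) - 2 * (v i * (if i = 0 then 1 else 0))))"
    unfolding s_def w_def by (intro sum.cong refl) (simp add: power2_eq_square algebra_simps)
  also have "\<dots> = 2 - 2 * v 0"
    unfolding sum.distrib sum_subtractf sum_distrib_left[symmetric] v
    using sum_if_eq_mult(2)[OF n, of v] sum_if_eq_mult(2)[OF n, of "\<lambda>_. 1 :: real"] by simp
  finally have s: "s = - 2 * w 0" by (simp add: w_def)
  show thesis
  proof (cases "s = 0")
    \<comment> \<open>Here \<open>v\<close> already is the first basis vector and there is no
      reflection to define.\<close>
    case True
    then have "v i = (if i = 0 then 1 else 0)" if "i < n" for i
      using that unfolding s_def w_def by (simp add: sum_nonneg_eq_0_iff)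
    then show thesis
      using n by (intro that[OF one_mem_orthogonal_group]) auto
  next
    case False
    define U where "U = mat n n (\<lambda>(i, j). (if i = j then 1 else 0) - 2 / s * (w i * w j))"
    show thesis
    proof (rule that)
      show "U \<in> orthogonal_group n"
      proof (rule orthogonal_groupI)
        fix i j assume ij: "i < n" "j < n"
        have "(\<Sum>x<n. U $$ (x, i) * U $$ (x, j)) =
          (\<Sum>x<n. (if x = i then 1 else 0) * (if x = j then 1 else 0)
             - 2 / s * w j * ((if x = i then 1 else 0) * w x)
             - 2 / s * w i * ((if x = j then 1 else 0) * w x)
             + (2 / s)\<^sup>2 * w i * w j * (w x)\<^sup>2)"
          using ij by (intro sum.cong refl) (simp add: U_def algebra_simps power2_eq_square)
        also have "\<dots> = (if i = j then 1 else 0) - 2 / s * w j * w i - 2 / s * w i * w j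
             + (2 / s)\<^sup>2 * w i * w j * s"
          unfolding sum.distrib sum_subtractf sum_distrib_left[symmetric] s_def[symmetric]
          using ij by (simp add: sum_if_eq_mult)
        also have "\<dots> = (if i = j then 1 else 0)"
          using False by (simp add: power2_eq_square field_simps)
        finally show "(\<Sum>x<n. U $$ (x, i) * U $$ (x, j)) = (if i = j then 1 else 0)" .
      qed (simp add: U_def)
      show "U $$ (i, 0) = v i" if "i < n" for i
      proof -
        \<comment> \<open>This is where the unit length of \<open>v\<close> enters: column 0 of the
          reflection becomes the first basis vector plus \<open>w\<close>.\<close>
        have "2 / s * w 0 = - 1" using False s by (simp add: field_simps)
        then have "2 / s * (w i * w 0) = - w i"
          by (metis mult.assoc mult.commute mult_minus1)
        with that n show ?thesis by (simp add: U_def w_def)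
      qed
    qed
  qed
qed

lemma symmetric_mat_index:
  "A \<in> carrier_mat n n \<Longrightarrow> transpose_mat A = A \<Longrightarrow> i < n \<Longrightarrow> j < n \<Longrightarrow> A $$ (i, j) = A $$ (j, i)"
  by (metis carrier_matD index_transpose_mat(1))

text \<open>A complex eigenvalue exists because the spectrum is nonempty. The Hermitian form of a
  real symmetric matrix takes real values, so the eigenvalue is real, and the real and imaginary
  parts of the eigenvector satisfy the same equation. One of them is nonzero and gets
  normalised.\<close>

lemma real_symmetric_eigenvector:
  fixes A :: "real mat"
  assumes A: "A \<in> carrier_mat n n" "transpose_mat A = A" and n: "n > 0"
  obtains v e where "(\<Sum>i<n. (v i)\<^sup>2) = 1" "\<And>i. i < n \<Longrightarrow> (\<Sum>j<n. A $$ (i, j) * v j) = e * v i"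
proof -
  define C where "C = map_mat complex_of_real A"
  have C: "C \<in> carrier_mat n n" using A by (simp add: C_def)
  obtain z where "eigenvalue C z"
    using spectrum_non_empty[OF C n] by (auto simp: spectrum_def)
  then obtain u where u: "u \<in> carrier_vec n" "u \<noteq> 0\<^sub>v n" "C *\<^sub>v u = z \<cdot>\<^sub>v u"
    using C by (auto simp: eigenvalue_def eigenvector_def)
  have Cu: "(\<Sum>j<n. of_real (A $$ (i, j)) * u $ j) = z * u $ i" if "i < n" for i
  proof -
    have "(C *\<^sub>v u) $ i = z * u $ i" using u that by simp
    then show ?thesis using that u A
      by (simp add: C_def scalar_prod_def lessThan_atLeast0)
  qed
  \<comment> \<open>The coordinate \<open>k\<close> decides at the end whether the real or the
    imaginary part is taken.\<close>
  obtain k where k: "k < n" "u $ k \<noteq> 0"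
    using u by (metis carrier_vecD eq_vecI index_zero_vec(1) index_zero_vec(2))
  define q where "q = (\<Sum>i<n. (cmod (u $ i))\<^sup>2)"
  have q: "q > 0"
    unfolding q_def using k by (intro sum_pos2[of _ k]) auto
  have zq: "z * of_real q = (\<Sum>i<n. \<Sum>j<n. of_real (A $$ (i, j)) * (cnj (u $ i) * u $ j))"
  proof -
    have "z * of_real q = (\<Sum>i<n. cnj (u $ i) * (z * u $ i))"
      by (simp add: q_def complex_norm_square sum_distrib_left mult_ac del: of_real_power)
    also have "\<dots> = (\<Sum>i<n. cnj (u $ i) * (\<Sum>j<n. of_real (A $$ (i, j)) * u $ j))"
      by (simp add: Cu)
    finally show ?thesis by (simp add: sum_distrib_left mult_ac)
  qed
  have "cnj (z * of_real q) = (\<Sum>i<n. \<Sum>j<n. of_real (A $$ (i, j)) * (u $ i * cnj (u $ j)))"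
    unfolding zq by simp
  also have "\<dots> = z * of_real q"
    unfolding zq by (subst sum.swap) (intro sum.cong refl, simp add: symmetric_mat_index[OF A] mult_ac)
  finally have "cnj z = z" using q by simp
  then have z: "z = of_real (Re z)" by (simp add: complex_eq_iff)
  have parts: "(\<Sum>j<n. A $$ (i, j) * Re (u $ j)) = Re z * Re (u $ i)"
    "(\<Sum>j<n. A $$ (i, j) * Im (u $ j)) = Re z * Im (u $ i)" if "i < n" for i
    using arg_cong[OF Cu[OF that], of Re] arg_cong[OF Cu[OF that], of Im] arg_cong[OF z, of Im]
    by simp_all
  note witness = that
  have norm: thesis if x: "\<And>i. i < n \<Longrightarrow> (\<Sum>j<n. A $$ (i, j) * x j) = Re z * x i"
    and xk: "x k \<noteq> 0" for x
  proof -
    define r where "r = sqrt (\<Sum>i<n. (x i)\<^sup>2)"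
    have pos: "(\<Sum>i<n. (x i)\<^sup>2) > 0"
      using k xk by (intro sum_pos2[of _ k]) auto
    then have r: "r > 0" "r\<^sup>2 = (\<Sum>i<n. (x i)\<^sup>2)" by (simp_all add: r_def)
    show thesis
    proof (rule witness)
      show "(\<Sum>i<n. (x i / r)\<^sup>2) = 1"
        using r pos by (simp add: power_divide sum_divide_distrib[symmetric])
      show "(\<Sum>j<n. A $$ (i, j) * (x j / r)) = Re z * (x i / r)" if "i < n" for i
        using x[OF that] by (simp add: sum_divide_distrib[symmetric])
    qed
  qed
  show thesis
  proof (cases "Re (u $ k) = 0")
    case True
    with k have "Im (u $ k) \<noteq> 0" by (simp add: complex_eq_iff)
    with norm[of "\<lambda>j. Im (u $ j)"] parts(2) show thesis by blast
  next
    case False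
    with norm[of "\<lambda>j. Re (u $ j)"] parts(1) show thesis by blast
  qed
qed

text \<open>The inner sum is kept separate so that the orthogonality of \<open>Q\<close> can be used
  for one index at a time.\<close>

lemma conj_index:
  fixes Q X :: "real mat"
  assumes "Q \<in> carrier_mat n n" "X \<in> carrier_mat n n" "i < n" "j < n"
  shows "(transpose_mat Q * X * Q) $$ (i, j) = (\<Sum>x<n. Q $$ (x, i) * (\<Sum>y<n. Q $$ (y, j) * X $$ (x, y)))"
proof -
  have "transpose_mat Q * X * Q = transpose_mat Q * (X * Q)"
    using assms by (intro assoc_mult_mat[of _ n n _ n _ n]) auto
  with assms show ?thesis
    by (simp add: scalar_prod_def lessThan_atLeast0 mult.commute)
qed

lemma transpose_conj:
  fixes Q X :: "real mat"
  assumes "Q \<in> carrier_mat n n" "X \<in> carrier_mat n n"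
  shows "transpose_mat (transpose_mat Q * X * Q) = transpose_mat Q * transpose_mat X * Q"
  using assms
  by (simp add: transpose_mult[of _ n n _ n] assoc_mult_mat[of _ n n _ n _ n])

text \<open>Deflation: an orthogonal matrix whose first column is a unit eigenvector splits off a 1
  by 1 block, and the induction hypothesis diagonalises the remaining block.\<close>

theorem real_spectral:
  fixes A :: "real mat"
  assumes "A \<in> carrier_mat n n" "transpose_mat A = A"
  shows "\<exists>Q\<in>orthogonal_group n. \<exists>d. transpose_mat Q * A * Q = mat n n (\<lambda>(i, j). if i = j then d i else 0)"
  using assms
proof (induction n arbitrary: A)
  case 0
  then show ?case by (intro bexI[of _ "1\<^sub>m 0"] exI) (auto simp: one_mem_orthogonal_group)
next
  case (Suc n)
  note A = Suc.prems
  obtain v e where v: "(\<Sum>i<Suc n. (v i)\<^sup>2) = 1"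
    and ev: "\<And>i. i < Suc n \<Longrightarrow> (\<Sum>j<Suc n. A $$ (i, j) * v j) = e * v i"
    using real_symmetric_eigenvector[OF A] by blast
  obtain U where U: "U \<in> orthogonal_group (Suc n)" "\<And>i. i < Suc n \<Longrightarrow> U $$ (i, 0) = v i"
    using orthogonal_group_first_col[OF _ v] by blast
  note Uc = orthogonal_group_carrier[OF U(1)]
  define A' where "A' = transpose_mat U * A * U"
  have A': "A' \<in> carrier_mat (Suc n) (Suc n)" "transpose_mat A' = A'"
    using Uc A transpose_conj[OF Uc A(1)] by (simp_all add: A'_def)
  \<comment> \<open>Column 0 of \<open>A'\<close> consists of \<open>e\<close> times the inner
    products of the columns of \<open>U\<close> with column 0.\<close>
  have col0: "A' $$ (i, 0) = (if i = 0 then e else 0)" if i: "i < Suc n" for i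
  proof -
    have "(\<Sum>y<Suc n. U $$ (y, 0) * A $$ (x, y)) = e * U $$ (x, 0)" if "x < Suc n" for x
      using ev[OF that] U(2) that by (simp add: mult.commute del: sum.lessThan_Suc)
    then have "A' $$ (i, 0) = (\<Sum>x<Suc n. U $$ (x, i) * (e * U $$ (x, 0)))"
      unfolding A'_def using conj_index[OF Uc A(1) i, of 0] by (simp del: sum.lessThan_Suc)
    also have "\<dots> = e * (\<Sum>x<Suc n. U $$ (x, i) * U $$ (x, 0))"
      by (simp add: sum_distrib_left mult_ac del: sum.lessThan_Suc)
    finally show ?thesis
      using orthogonal_group_cols[OF U(1) i, of 0] by simp
  qed
  have row0: "A' $$ (0, i) = (if i = 0 then e else 0)" if i: "i < Suc n" for i
    using symmetric_mat_index[OF A', of 0 i] col0[OF i] i by simp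
  define A3 where "A3 = mat n n (\<lambda>(i, j). A' $$ (Suc i, Suc j))"
  have A3: "A3 \<in> carrier_mat n n" "transpose_mat A3 = A3"
    using symmetric_mat_index[OF A'] by (auto simp: A3_def intro!: eq_matI)
  obtain Q d where Q: "Q \<in> orthogonal_group n"
    and d: "transpose_mat Q * A3 * Q = mat n n (\<lambda>(i, j). if i = j then d i else 0)"
    using Suc.IH[OF A3] by blast
  note Qc = orthogonal_group_carrier[OF Q]
  have blk: "A' = four_block_mat (mat 1 1 (\<lambda>_. e)) (0\<^sub>m 1 n) (0\<^sub>m n 1) A3"
    using A' col0 row0 by (auto intro!: eq_matI simp: A3_def)
  define W where "W = four_block_mat (1\<^sub>m 1) (0\<^sub>m 1 n) (0\<^sub>m n 1) Q"
  have Wt: "transpose_mat W = four_block_mat (1\<^sub>m 1) (0\<^sub>m 1 n) (0\<^sub>m n 1) (transpose_mat Q)"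
    unfolding W_def using Qc by (subst transpose_four_block_mat[of _ 1 1 _ n _ n]) auto
  have Wc: "W \<in> carrier_mat (Suc n) (Suc n)"
    using Qc four_block_carrier_mat[of "1\<^sub>m 1" 1 1 Q n n] by (simp add: W_def)
  have "transpose_mat W * W = four_block_mat (1\<^sub>m 1) (0\<^sub>m 1 n) (0\<^sub>m n 1) (1\<^sub>m n)"
    unfolding Wt unfolding W_def using Qc orthogonal_group_transpose_mult[OF Q]
    by (subst mult_four_block_mat[of _ 1 1 _ n _ n _ _ 1 _ n]) auto
  also have "\<dots> = 1\<^sub>m (Suc n)" by (auto intro!: eq_matI)
  finally have W: "W \<in> orthogonal_group (Suc n)"
    using Wc by (simp add: orthogonal_group_def)
  have "transpose_mat W * A' * W =
      four_block_mat (mat 1 1 (\<lambda>_. e)) (0\<^sub>m 1 n) (0\<^sub>m n 1) (transpose_mat Q * A3 * Q)"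
    unfolding Wt blk unfolding W_def using Qc A3
    by (subst mult_four_block_mat[of _ 1 1 _ n _ n _ _ 1 _ n], auto,
        subst mult_four_block_mat[of _ 1 1 _ n _ n _ _ 1 _ n], auto)
  also have "\<dots> = mat (Suc n) (Suc n) (\<lambda>(i, j). if i = j then (case i of 0 \<Rightarrow> e | Suc i \<Rightarrow> d i) else 0)"
    unfolding d by (rule eq_matI) (auto split: nat.split)
  finally have diag: "transpose_mat W * A' * W = \<dots>" .
  have "transpose_mat (U * W) * A * (U * W) = transpose_mat W * A' * W"
    unfolding A'_def using Uc Wc A
    by (simp add: transpose_mult[of _ "Suc n" "Suc n" _ "Suc n"]
        assoc_mult_mat[of _ "Suc n" "Suc n" _ "Suc n" _ "Suc n"])
  with diag mult_mem_orthogonal_group[OF U(1) W] show ?case by auto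
qed

section \<open>The Laplacian of a weighted graph\<close>

text \<open>Lagrange's identity: the squared differences on the right expand into products of single
  sums. With the weights around a vertex it measures how far the neighbours disagree.\<close>

lemma weighted_variance:
  fixes w x :: "'v \<Rightarrow> real"
  shows "(\<Sum>v\<in>V. w v) * (\<Sum>v\<in>V. w v * (x v)\<^sup>2) - (\<Sum>v\<in>V. w v * x v)\<^sup>2 =
    (\<Sum>u\<in>V. \<Sum>v\<in>V. w u * w v * (x u - x v)\<^sup>2) / 2"
proof -
  have "(\<Sum>u\<in>V. \<Sum>v\<in>V. w u * w v * (x u - x v)\<^sup>2) =
     (\<Sum>u\<in>V. \<Sum>v\<in>V. (w u * (x u)\<^sup>2) * w v) + (\<Sum>u\<in>V. \<Sum>v\<in>V. w u * (w v * (x v)\<^sup>2))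
      - 2 * (\<Sum>u\<in>V. \<Sum>v\<in>V. (w u * x u) * (w v * x v))"
    unfolding sum.distrib[symmetric] sum_subtractf[symmetric] sum_distrib_left[of 2]
    by (intro sum.cong refl) (simp add: algebra_simps power2_eq_square)
  then show ?thesis
    unfolding sum_product[symmetric] by (simp add: power2_eq_square mult.commute)
qed

text \<open>\<open>M\<close> bounds the total edge weight; the factor 2 in \<open>total_le\<close>
  appears because the double sum meets every edge from both ends. The potential \<open>l\<close>
  will be the spectrum of a matrix.\<close>

locale weighted_graph =
  fixes V :: "'v set" and w :: "'v \<Rightarrow> 'v \<Rightarrow> real" and M :: real and l :: "'v \<Rightarrow> real"
  assumes finite_V: "finite V"
    and w_sym: "u \<in> V \<Longrightarrow> v \<in> V \<Longrightarrow> w u v = w v u"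
    and w_diag: "u \<in> V \<Longrightarrow> w u u = 0"
    and w_nonneg: "u \<in> V \<Longrightarrow> v \<in> V \<Longrightarrow> 0 \<le> w u v"
    and w_le_1: "u \<in> V \<Longrightarrow> v \<in> V \<Longrightarrow> w u v \<le> 1"
    and total_le: "(\<Sum>u\<in>V. \<Sum>v\<in>V. w u v) \<le> 2 * M"
begin

definition "deg u = (\<Sum>v\<in>V. w u v)"

definition "lap u = (\<Sum>v\<in>V. w u v * (l u - l v))"

definition "energy = (\<Sum>u\<in>V. \<Sum>v\<in>V. w u v * (l u - l v)\<^sup>2) / 2"

lemma M_nonneg: "0 \<le> M"
proof -
  have "0 \<le> (\<Sum>u\<in>V. \<Sum>v\<in>V. w u v)"
    by (intro sum_nonneg w_nonneg)
  with total_le show ?thesis by simp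
qed

lemma sum_swap_sym:
  assumes "\<And>u v. u \<in> V \<Longrightarrow> v \<in> V \<Longrightarrow> f u v = g v u"
  shows "(\<Sum>u\<in>V. \<Sum>v\<in>V. f u v) = (\<Sum>u\<in>V. \<Sum>v\<in>V. (g u v :: real))"
  by (subst (2) sum.swap) (intro sum.cong refl assms)

lemma sum_lap: "(\<Sum>u\<in>V. lap u) = 0"
proof -
  have "(\<Sum>u\<in>V. lap u) = (\<Sum>u\<in>V. \<Sum>v\<in>V. - (w u v * (l u - l v)))"
    unfolding lap_def by (rule sum_swap_sym) (simp add: w_sym algebra_simps)
  also have "\<dots> = - (\<Sum>u\<in>V. lap u)"
    by (simp add: lap_def sum_negf)
  finally show ?thesis by simp
qed

lemma sum_mult_lap: "(\<Sum>u\<in>V. l u * lap u) = energy"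
proof -
  have "(\<Sum>u\<in>V. l u * lap u) = (\<Sum>u\<in>V. \<Sum>v\<in>V. l u * (w u v * (l u - l v)))"
    by (simp add: lap_def sum_distrib_left)
  moreover have "\<dots> = (\<Sum>u\<in>V. \<Sum>v\<in>V. - (l v * (w u v * (l u - l v))))"
    by (rule sum_swap_sym) (simp add: w_sym algebra_simps)
  moreover have "(\<Sum>u\<in>V. \<Sum>v\<in>V. l u * (w u v * (l u - l v))) + (\<Sum>u\<in>V. \<Sum>v\<in>V. - (l v * (w u v * (l u - l v)))) =
      2 * energy"
    unfolding energy_def sum.distrib[symmetric]
    by (simp add: algebra_simps power2_eq_square)
  ultimately show ?thesis by linarith
qed

text \<open>Doubled degrees count the rows and columns of \<open>u\<close> and \<open>v\<close>,
  where the edge between them is met twice too often. The exact remainder, the weight avoiding both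
  vertices, is kept because the equality case needs it to vanish.\<close>

lemma deg_sum_slack:
  assumes u: "u \<in> V" and v: "v \<in> V" and "u \<noteq> v"
  shows "2 * deg u + 2 * deg v + (\<Sum>x\<in>V-{u,v}. \<Sum>y\<in>V-{u,v}. w x y) =
    (\<Sum>x\<in>V. \<Sum>y\<in>V. w x y) + 2 * w u v"
proof -
  have split: "(\<Sum>x\<in>V. f x) = f u + f v + (\<Sum>x\<in>V-{u,v}. f x)" for f :: "'v \<Rightarrow> real"
  proof -
    have V: "V = insert u (insert v (V - {u,v}))" using u v by auto
    show ?thesis
      by (subst V) (use finite_V \<open>u \<noteq> v\<close> in simp)
  qed
  have "(\<Sum>x\<in>V. \<Sum>y\<in>V. w x y) = deg u + deg v + (\<Sum>x\<in>V-{u,v}. deg x)"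
    by (subst split) (simp add: deg_def)
  also have "(\<Sum>x\<in>V-{u,v}. deg x) =
     (\<Sum>x\<in>V-{u,v}. w x u) + (\<Sum>x\<in>V-{u,v}. w x v) + (\<Sum>x\<in>V-{u,v}. \<Sum>y\<in>V-{u,v}. w x y)"
    unfolding deg_def by (subst split) (simp add: sum.distrib)
  also have "(\<Sum>x\<in>V-{u,v}. w x u) = (\<Sum>x\<in>V-{u,v}. w u x)"
    using u by (intro sum.cong) (auto simp: w_sym)
  also have "\<dots> = deg u - w u v"
    unfolding deg_def by (subst split) (use u w_diag in simp)
  also have "(\<Sum>x\<in>V-{u,v}. w x v) = (\<Sum>x\<in>V-{u,v}. w v x)"
    using v by (intro sum.cong) (auto simp: w_sym)
  also have "\<dots> = deg v - w u v"
    unfolding deg_def by (subst split) (use u v w_diag w_sym in simp)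
  finally show ?thesis by simp
qed

lemma deg_sum_le:
  assumes u: "u \<in> V" and v: "v \<in> V" and "u \<noteq> v"
  shows "deg u + deg v \<le> M + 1"
proof -
  have "0 \<le> (\<Sum>x\<in>V-{u,v}. \<Sum>y\<in>V-{u,v}. w x y)"
    by (intro sum_nonneg w_nonneg) auto
  with deg_sum_slack[OF assms] total_le w_le_1[OF u v] show ?thesis by linarith
qed

text \<open>A certificate by nonnegative terms: the residual of the eigenvalue equation for
  \<open>M + 1\<close>, the disagreement among neighbours of a common vertex, and the degree slack
  along the edges. On expansion the squares of \<open>lap\<close> and the degree-weighted terms
  cancel.\<close>

lemma energy_identity:
  "(M + 1) * ((M + 1) * (\<Sum>u\<in>V. (l u)\<^sup>2) - energy) =
     (\<Sum>u\<in>V. (lap u - (M + 1) * l u)\<^sup>2) +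
     (\<Sum>u\<in>V. \<Sum>v\<in>V. \<Sum>v'\<in>V. w u v * w u v' * (l v - l v')\<^sup>2) / 2 +
     (\<Sum>u\<in>V. \<Sum>v\<in>V. w u v * (M + 1 - deg u - deg v) * (l u - l v)\<^sup>2) / 2"
proof -
  define S where "S u = (\<Sum>v\<in>V. w u v * (l u - l v)\<^sup>2)" for u
  have 1: "(\<Sum>u\<in>V. (lap u - (M + 1) * l u)\<^sup>2) =
     (\<Sum>u\<in>V. (lap u)\<^sup>2) - 2 * (M + 1) * energy + (M + 1)\<^sup>2 * (\<Sum>u\<in>V. (l u)\<^sup>2)"
    unfolding sum_mult_lap[symmetric] sum_distrib_left sum_subtractf[symmetric] sum.distrib[symmetric]
    by (intro sum.cong refl) (simp add: power2_eq_square algebra_simps)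
  have "(\<Sum>v\<in>V. \<Sum>v'\<in>V. w u v * w u v' * (l v - l v')\<^sup>2) / 2 = deg u * S u - (lap u)\<^sup>2" for u
    using weighted_variance[of "w u" V "\<lambda>v. l u - l v"]
    by (simp add: deg_def S_def lap_def power2_commute)
  then have 2: "(\<Sum>u\<in>V. \<Sum>v\<in>V. \<Sum>v'\<in>V. w u v * w u v' * (l v - l v')\<^sup>2) / 2 =
      (\<Sum>u\<in>V. deg u * S u) - (\<Sum>u\<in>V. (lap u)\<^sup>2)"
    by (simp add: sum_divide_distrib sum_subtractf)
  have energy2: "2 * energy = (\<Sum>u\<in>V. \<Sum>v\<in>V. w u v * (l u - l v)\<^sup>2)"
    by (simp add: energy_def)
  have "(\<Sum>u\<in>V. \<Sum>v\<in>V. w u v * deg v * (l u - l v)\<^sup>2) = (\<Sum>u\<in>V. \<Sum>v\<in>V. w u v * deg u * (l u - l v)\<^sup>2)"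
    by (rule sum_swap_sym) (simp add: w_sym power2_commute)
  moreover have "(\<Sum>u\<in>V. \<Sum>v\<in>V. w u v * deg u * (l u - l v)\<^sup>2) = (\<Sum>u\<in>V. deg u * S u)"
    by (simp add: S_def sum_distrib_left mult_ac)
  moreover have "(\<Sum>u\<in>V. \<Sum>v\<in>V. w u v * (M + 1 - deg u - deg v) * (l u - l v)\<^sup>2) =
     (M + 1) * (2 * energy) - (\<Sum>u\<in>V. \<Sum>v\<in>V. w u v * deg u * (l u - l v)\<^sup>2)
       - (\<Sum>u\<in>V. \<Sum>v\<in>V. w u v * deg v * (l u - l v)\<^sup>2)"
    unfolding energy2 sum_distrib_left sum_subtractf[symmetric]
    by (intro sum.cong refl) (simp add: algebra_simps)
  ultimately have 3: "(\<Sum>u\<in>V. \<Sum>v\<in>V. w u v * (M + 1 - deg u - deg v) * (l u - l v)\<^sup>2) / 2 =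
     (M + 1) * energy - (\<Sum>u\<in>V. deg u * S u)"
    by simp
  show ?thesis
    unfolding 1 2 3 by (simp add: algebra_simps power2_eq_square)
qed

lemma edge_term_nonneg:
  assumes "u \<in> V" "v \<in> V"
  shows "0 \<le> w u v * (M + 1 - deg u - deg v) * (l u - l v)\<^sup>2"
\<comment> \<open>For \<open>u = v\<close> the middle factor may be negative, but the difference of
  potentials is zero.\<close>
proof (cases "u = v")
  case False
  with assms deg_sum_le[of u v] have "0 \<le> M + 1 - deg u - deg v" by simp
  with assms show ?thesis
    by (intro mult_nonneg_nonneg w_nonneg zero_le_power2)
qed simp

lemma square_terms_nonneg:
  "0 \<le> (\<Sum>u\<in>V. (lap u - (M + 1) * l u)\<^sup>2)"
  "0 \<le> (\<Sum>u\<in>V. \<Sum>v\<in>V. \<Sum>v'\<in>V. w u v * w u v' * (l v - l v')\<^sup>2)"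
  "0 \<le> (\<Sum>u\<in>V. \<Sum>v\<in>V. w u v * (M + 1 - deg u - deg v) * (l u - l v)\<^sup>2)"
  by (rule sum_nonneg, simp)
    ((intro sum_nonneg mult_nonneg_nonneg w_nonneg zero_le_power2; assumption),
     (intro sum_nonneg edge_term_nonneg; assumption))

theorem energy_le: "energy \<le> (M + 1) * (\<Sum>u\<in>V. (l u)\<^sup>2)"
proof -
  have "0 \<le> (M + 1) * ((M + 1) * (\<Sum>u\<in>V. (l u)\<^sup>2) - energy)"
    unfolding energy_identity using square_terms_nonneg by simp
  with M_nonneg show ?thesis
    by (simp add: zero_le_mult_iff)
qed

text \<open>Equality kills all three terms of \<open>energy_identity\<close>: \<open>l\<close> is an
  eigenvector of the Laplacian for \<open>M + 1\<close>, neighbours of a common vertex share their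
  potential, and an edge joining different potentials leaves no weight away from its ends. Such an
  edge with a pendant end \<open>b\<close> makes \<open>a\<close> the centre of a star.\<close>

theorem energy_eq_imp_star:
  assumes eq: "energy = (M + 1) * (\<Sum>u\<in>V. (l u)\<^sup>2)" and l: "(\<Sum>u\<in>V. (l u)\<^sup>2) > 0"
  obtains a b where "a \<in> V" "b \<in> V" "a \<noteq> b" "l b \<noteq> 0" "l a = - M * l b" "w a b = 1"
    "\<And>u. u \<in> V \<Longrightarrow> u \<noteq> a \<Longrightarrow> l u = 0 \<or> l u = l b"
    "\<And>u v. u \<in> V \<Longrightarrow> v \<in> V \<Longrightarrow> u \<noteq> a \<Longrightarrow> v \<noteq> a \<Longrightarrow> w u v = 0"
    "(\<Sum>u\<in>V. l u) = 0" "(\<Sum>u\<in>V. \<Sum>v\<in>V. w u v) = 2 * M"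
    "\<And>u. u \<in> V \<Longrightarrow> u \<noteq> a \<Longrightarrow> w u a = 0 \<Longrightarrow> l u = 0" "(\<Sum>v\<in>V. w a v) = M"
proof -
  note M = M_nonneg
  have sum0: "(\<Sum>u\<in>V. (lap u - (M + 1) * l u)\<^sup>2) = 0"
    "(\<Sum>u\<in>V. \<Sum>v\<in>V. \<Sum>v'\<in>V. w u v * w u v' * (l v - l v')\<^sup>2) = 0"
    "(\<Sum>u\<in>V. \<Sum>v\<in>V. w u v * (M + 1 - deg u - deg v) * (l u - l v)\<^sup>2) = 0"
    using energy_identity eq square_terms_nonneg by simp_all
  have lap: "lap u = (M + 1) * l u" if "u \<in> V" for u
    using sum0(1) that finite_V by (simp add: sum_nonneg_eq_0_iff)
  have nbr: "l v = l v'" if "u \<in> V" "v \<in> V" "v' \<in> V" "w u v \<noteq> 0" "w u v' \<noteq> 0" for u v v'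
  proof -
    have "\<forall>u\<in>V. \<forall>v\<in>V. w u v = 0 \<or> (\<forall>v'\<in>V. w u v' = 0 \<or> l v = l v')"
      using sum0(2) finite_V by (simp add: sum_nonneg_eq_0_iff sum_nonneg w_nonneg)
    with that show ?thesis by blast
  qed
  have active: "w u v = 1 \<and> (\<Sum>x\<in>V. \<Sum>y\<in>V. w x y) = 2 * M \<and>
      (\<forall>x\<in>V-{u,v}. \<forall>y\<in>V-{u,v}. w x y = 0) \<and> deg u + deg v = M + 1"
    if uv: "u \<in> V" "v \<in> V" "w u v \<noteq> 0" "l u \<noteq> l v" for u v
  proof -
    have "\<forall>u\<in>V. \<forall>v\<in>V. w u v * (M + 1 - deg u - deg v) * (l u - l v)\<^sup>2 = 0"
      using sum0(3) finite_V
      by (simp add: sum_nonneg_eq_0_iff sum_nonneg edge_term_nonneg del: mult_eq_0_iff)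
    then have "w u v * (M + 1 - deg u - deg v) * (l u - l v)\<^sup>2 = 0"
      using uv by blast
    with uv have deg: "deg u + deg v = M + 1" by simp
    have ne: "u \<noteq> v" using uv by auto
    have nn: "0 \<le> (\<Sum>x\<in>V-{u,v}. \<Sum>y\<in>V-{u,v}. w x y)"
      by (intro sum_nonneg w_nonneg) auto
    note sl = deg_sum_slack[OF uv(1,2) ne]
    \<comment> \<open>The three estimates behind \<open>deg_sum_le\<close> must all be
      tight.\<close>
    have "(\<Sum>x\<in>V-{u,v}. \<Sum>y\<in>V-{u,v}. w x y) = 0" "w u v = 1" "(\<Sum>x\<in>V. \<Sum>y\<in>V. w x y) = 2 * M"
      using deg sl nn total_le w_le_1[OF uv(1,2)] by linarith+
    moreover have "\<forall>x\<in>U. \<forall>y\<in>U. w x y = 0"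
      if "(\<Sum>x\<in>U. \<Sum>y\<in>U. w x y) = 0" "U \<subseteq> V" for U
    proof -
      have "finite U" "\<And>x y. x \<in> U \<Longrightarrow> y \<in> U \<Longrightarrow> 0 \<le> w x y"
        using that finite_V by (auto intro: finite_subset w_nonneg)
      with that(1) show ?thesis by (simp add: sum_nonneg_eq_0_iff sum_nonneg)
    qed
    ultimately show ?thesis using deg by blast
  qed
  \<comment> \<open>Positive energy supplies an edge between different potentials.\<close>
  have "energy > 0" using eq l M by simp
  then have "\<exists>a\<in>V. \<exists>b\<in>V. w a b * (l a - l b)\<^sup>2 \<noteq> 0"
    by (rule contrapos_pp) (simp add: energy_def)
  then obtain a b where ab: "a \<in> V" "b \<in> V" "w a b \<noteq> 0" "l a \<noteq> l b"
    by (metis diff_self mult_zero_left mult_zero_right zero_power2)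
  \<comment> \<open>Two pendant edges at opposite ends of an active edge would have to share their far end,
    which then has the potential of both ends.\<close>
  have end_pt: "(\<forall>k\<in>V-{a}. w b k = 0) \<or> (\<forall>j\<in>V-{b}. w a j = 0)"
  proof (rule ccontr)
    assume "\<not> ?thesis"
    then obtain k j where kj: "k \<in> V" "k \<noteq> a" "w b k \<noteq> 0" "j \<in> V" "j \<noteq> b" "w a j \<noteq> 0" by blast
    have lj: "l j = l b" using nbr[of a j b] kj ab by simp
    have lk: "l k = l a" using nbr[of b k a] kj ab w_sym[of a b] by simp
    have "k \<noteq> j" using lj lk ab by auto
    moreover have "\<forall>x\<in>V-{a,j}. \<forall>y\<in>V-{a,j}. w x y = 0"
      using active[of a j] kj ab lj by simp
    moreover have "b \<noteq> a" using ab by auto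
    ultimately show False using kj ab by blast
  qed
  \<comment> \<open>The two ends are exchanged if necessary, so that \<open>b\<close> is the pendant
    one.\<close>
  obtain a b where ab: "a \<in> V" "b \<in> V" "w a b \<noteq> 0" "l a \<noteq> l b" and leaf: "\<forall>k\<in>V-{a}. w b k = 0"
  proof -
    from end_pt show thesis
    proof
      assume "\<forall>k\<in>V-{a}. w b k = 0"
      from that[OF ab this] show thesis .
    next
      assume "\<forall>j\<in>V-{b}. w a j = 0"
      from that[of b a, OF _ _ _ _ this] ab w_sym[of a b] show thesis by auto
    qed
  qed
  have ne: "a \<noteq> b" using ab by auto
  have wab: "w a b = 1" and tot: "(\<Sum>u\<in>V. \<Sum>v\<in>V. w u v) = 2 * M" and dab: "deg a + deg b = M + 1"
    and off: "\<forall>x\<in>V-{a,b}. \<forall>y\<in>V-{a,b}. w x y = 0"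
    using active[OF ab] by auto
  have star: "w u v = 0" if "u \<in> V" "v \<in> V" "u \<noteq> a" "v \<noteq> a" for u v
    using that leaf off w_sym[of u b] ab by (cases "u = b"; cases "v = b") auto
  have deg_b: "deg b = 1"
  proof -
    have "deg b = (\<Sum>v\<in>{a}. w b v)"
      unfolding deg_def using leaf ab finite_V by (intro sum.mono_neutral_right) auto
    with wab w_sym ab show ?thesis by simp
  qed
  have lap_at: "lap u = w u a * (l u - l a)" if "u \<in> V" "u \<noteq> a" for u
  proof -
    have "lap u = (\<Sum>v\<in>{a}. w u v * (l u - l v))"
      unfolding lap_def using star that ab finite_V by (intro sum.mono_neutral_right) auto
    then show ?thesis by simp
  qed
  \<comment> \<open>The eigenvalue equation at \<open>b\<close>, whose only edge goes to
    \<open>a\<close> with weight 1.\<close>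
  have "l b - l a = (M + 1) * l b"
    using lap[of b] lap_at[of b] ab ne wab w_sym[of a b] by simp
  then have la: "l a = - M * l b" by (simp add: algebra_simps)
  have lb: "l b \<noteq> 0" using la ab by auto
  \<comment> \<open>Without an edge the Laplacian vanishes at \<open>u\<close>, while the eigenvalue
    \<open>M + 1\<close> is positive.\<close>
  have isolated: "l u = 0" if "u \<in> V" "u \<noteq> a" "w u a = 0" for u
    using lap[of u] lap_at[of u] that M by simp
  have lu: "l u = 0 \<or> l u = l b" if "u \<in> V" "u \<noteq> a" for u
    using isolated[of u] nbr[of a u b] that ab w_sym[of a u] by auto
  have "(M + 1) * (\<Sum>u\<in>V. l u) = 0"
    using sum_lap lap by (simp add: sum_distrib_left)
  then have sum_l: "(\<Sum>u\<in>V. l u) = 0" using M by simp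
  have deg_a: "(\<Sum>v\<in>V. w a v) = M"
    using dab deg_b by (simp add: deg_def)
  show thesis
    by (rule that[OF ab(1,2) ne lb la wab lu star sum_l tot isolated deg_a])
qed

end

section \<open>A quadratic form bounded by its row sums\<close>

text \<open>By symmetry the terms linear in \<open>d\<close> collect into row sums weighted by
  \<open>y\<close>, and the row sums are at most \<open>card S\<close>.\<close>

lemma quad_form_shift:
  fixes c :: "'a \<Rightarrow> 'a \<Rightarrow> real"
  assumes sym: "\<And>i j. i \<in> S \<Longrightarrow> j \<in> S \<Longrightarrow> c i j = c j i"
    and row: "\<And>i. i \<in> S \<Longrightarrow> (\<Sum>j\<in>S. c i j) \<le> card S"
    and y: "\<And>i. i \<in> S \<Longrightarrow> 0 \<le> y i" and d: "0 \<le> d"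
  shows "(\<Sum>i\<in>S. \<Sum>j\<in>S. (y i + d) * (y j + d) * c i j) \<le>
    (\<Sum>i\<in>S. \<Sum>j\<in>S. y i * y j * c i j) + 2 * d * card S * (\<Sum>i\<in>S. y i) + d\<^sup>2 * (\<Sum>i\<in>S. \<Sum>j\<in>S. c i j)"
proof -
  have "(\<Sum>i\<in>S. \<Sum>j\<in>S. y j * c i j) = (\<Sum>i\<in>S. y i * (\<Sum>j\<in>S. c i j))"
    unfolding sum_distrib_left by (subst sum.swap) (simp add: sym)
  moreover have "(\<Sum>i\<in>S. \<Sum>j\<in>S. y i * c i j) = (\<Sum>i\<in>S. y i * (\<Sum>j\<in>S. c i j))"
    by (simp add: sum_distrib_left)
  moreover have "(\<Sum>i\<in>S. \<Sum>j\<in>S. (y i + d) * (y j + d) * c i j) =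
     (\<Sum>i\<in>S. \<Sum>j\<in>S. y i * y j * c i j) + d * (\<Sum>i\<in>S. \<Sum>j\<in>S. y i * c i j)
      + d * (\<Sum>i\<in>S. \<Sum>j\<in>S. y j * c i j) + d\<^sup>2 * (\<Sum>i\<in>S. \<Sum>j\<in>S. c i j)"
    unfolding sum_distrib_left sum.distrib[symmetric]
    by (intro sum.cong refl) (simp add: algebra_simps power2_eq_square)
  moreover have "(\<Sum>i\<in>S. y i * (\<Sum>j\<in>S. c i j)) \<le> (\<Sum>i\<in>S. y i * card S)"
    by (intro sum_mono mult_left_mono row y)
  then have "2 * d * (\<Sum>i\<in>S. y i * (\<Sum>j\<in>S. c i j)) \<le> 2 * d * (\<Sum>i\<in>S. y i * card S)"
    using d by (intro mult_left_mono) auto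
  moreover have "2 * d * (\<Sum>i\<in>S. y i * card S) = 2 * d * card S * (\<Sum>i\<in>S. y i)"
    by (simp add: sum_distrib_right[symmetric] mult_ac)
  ultimately show ?thesis by (simp only:)
qed

text \<open>With \<open>d\<close> the smallest value of \<open>x\<close> and \<open>y\<close> the
  excess over it, induction bounds the form in \<open>y\<close> by the square of the sum of
  \<open>y\<close>. The terms added by \<open>quad_form_shift\<close> then complete the square of
  the sum of \<open>y\<close> plus \<open>d * card S\<close>.\<close>

theorem quad_form_le:
  fixes c :: "'a \<Rightarrow> 'a \<Rightarrow> real"
  assumes "finite S"
    and sym: "\<And>i j. i \<in> S \<Longrightarrow> j \<in> S \<Longrightarrow> c i j = c j i"
    and row: "\<And>T i. T \<subseteq> S \<Longrightarrow> i \<in> T \<Longrightarrow> (\<Sum>j\<in>T. c i j) \<le> card T"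
    and x: "\<And>i. i \<in> S \<Longrightarrow> 0 \<le> x i"
  shows "(\<Sum>i\<in>S. \<Sum>j\<in>S. x i * x j * c i j) \<le> (\<Sum>i\<in>S. x i)\<^sup>2"
  using assms
proof (induction S arbitrary: x rule: finite_psubset_induct)
  case (psubset S)
  show ?case
  proof (cases "S = {}")
    case False
    define d where "d = Min (x ` S)"
    have "d \<in> x ` S" unfolding d_def using psubset.hyps False by (intro Min_in) auto
    then obtain k where k: "k \<in> S" "x k = d" by auto
    have xd: "d \<le> x i" if "i \<in> S" for i
      unfolding d_def using psubset.hyps that by simp
    have d: "0 \<le> d" using k psubset.prems(3) by force
    define y where "y i = x i - d" for i
    have yk: "y k = 0" and y: "\<And>i. i \<in> S \<Longrightarrow> 0 \<le> y i" using k xd by (auto simp: y_def)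
    let ?T = "S - {k}"
    have sumk: "sum f S = sum f ?T" if "f k = 0" for f :: "'a \<Rightarrow> real"
      using psubset.hyps k that by (simp add: sum.remove)
    \<comment> \<open>The index \<open>k\<close> attaining the minimum drops out of the form in
      \<open>y\<close>, which therefore lives on a proper subset.\<close>
    have "(\<Sum>i\<in>?T. \<Sum>j\<in>?T. y i * y j * c i j) \<le> (\<Sum>i\<in>?T. y i)\<^sup>2"
    proof (rule psubset.IH)
      show "(\<Sum>j\<in>T. c i j) \<le> card T" if "T \<subseteq> ?T" "i \<in> T" for T i
        by (rule psubset.prems(2)) (use that in auto)
    qed (use k psubset.prems(1) y in auto)
    moreover have "(\<Sum>i\<in>S. \<Sum>j\<in>S. y i * y j * c i j) = (\<Sum>i\<in>?T. \<Sum>j\<in>?T. y i * y j * c i j)"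
      using yk by (simp add: sumk)
    moreover have "(\<Sum>i\<in>S. y i) = (\<Sum>i\<in>?T. y i)" using yk by (simp add: sumk)
    ultimately have Qy: "(\<Sum>i\<in>S. \<Sum>j\<in>S. y i * y j * c i j) \<le> (\<Sum>i\<in>S. y i)\<^sup>2" by simp
    have row: "\<And>i. i \<in> S \<Longrightarrow> (\<Sum>j\<in>S. c i j) \<le> card S" using psubset.prems(2) by blast
    have "(\<Sum>i\<in>S. \<Sum>j\<in>S. c i j) \<le> (\<Sum>i\<in>S. card S)" unfolding of_nat_sum
      by (intro sum_mono row)
    then have tot: "d\<^sup>2 * (\<Sum>i\<in>S. \<Sum>j\<in>S. c i j) \<le> d\<^sup>2 * (card S)\<^sup>2"
      by (intro mult_left_mono) (auto simp: power2_eq_square)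
    have "(\<Sum>i\<in>S. x i) = (\<Sum>i\<in>S. y i) + d * card S"
      by (simp add: y_def sum_subtractf)
    then have "(\<Sum>i\<in>S. x i)\<^sup>2 = (\<Sum>i\<in>S. y i)\<^sup>2 + 2 * d * card S * (\<Sum>i\<in>S. y i) + d\<^sup>2 * (card S)\<^sup>2"
      by (simp add: power2_eq_square algebra_simps)
    moreover have "(\<Sum>i\<in>S. \<Sum>j\<in>S. x i * x j * c i j) = (\<Sum>i\<in>S. \<Sum>j\<in>S. (y i + d) * (y j + d) * c i j)"
      by (simp add: y_def)
    ultimately show ?thesis
      using quad_form_shift[of S c y d] psubset.prems(1) row y d Qy tot by fastforce
  qed simp
qed

text \<open>For positive \<open>x\<close> the minimum \<open>d\<close> is positive. Equality then
  pushes the sum of all \<open>c i j\<close> up to the square of \<open>card S\<close>, which leaves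
  no slack in any single row.\<close>

theorem quad_form_eq_imp_row:
  fixes c :: "'a \<Rightarrow> 'a \<Rightarrow> real"
  assumes fin: "finite S"
    and sym: "\<And>i j. i \<in> S \<Longrightarrow> j \<in> S \<Longrightarrow> c i j = c j i"
    and row: "\<And>T i. T \<subseteq> S \<Longrightarrow> i \<in> T \<Longrightarrow> (\<Sum>j\<in>T. c i j) \<le> card T"
    and x: "\<And>i. i \<in> S \<Longrightarrow> 0 < x i"
    and eq: "(\<Sum>i\<in>S. \<Sum>j\<in>S. x i * x j * c i j) = (\<Sum>i\<in>S. x i)\<^sup>2"
    and k: "k \<in> S"
  shows "(\<Sum>j\<in>S. c k j) = card S"
proof -
  define d where "d = Min (x ` S)"
  have "d \<in> x ` S" unfolding d_def using fin k by (intro Min_in) auto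
  then have d: "0 < d" using x by auto
  have xd: "d \<le> x i" if "i \<in> S" for i
    unfolding d_def using fin that by simp
  define y where "y i = x i - d" for i
  have y: "\<And>i. i \<in> S \<Longrightarrow> 0 \<le> y i" using xd by (auto simp: y_def)
  have row': "\<And>i. i \<in> S \<Longrightarrow> (\<Sum>j\<in>S. c i j) \<le> card S" using row by blast
  have Qy: "(\<Sum>i\<in>S. \<Sum>j\<in>S. y i * y j * c i j) \<le> (\<Sum>i\<in>S. y i)\<^sup>2"
    by (rule quad_form_le[OF fin sym row y])
  have "(\<Sum>i\<in>S. x i) = (\<Sum>i\<in>S. y i) + d * card S"
    by (simp add: y_def sum_subtractf)
  then have "(\<Sum>i\<in>S. x i)\<^sup>2 = (\<Sum>i\<in>S. y i)\<^sup>2 + 2 * d * card S * (\<Sum>i\<in>S. y i) + d\<^sup>2 * (card S)\<^sup>2"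
    by (simp add: power2_eq_square algebra_simps)
  moreover have "(\<Sum>i\<in>S. \<Sum>j\<in>S. x i * x j * c i j) = (\<Sum>i\<in>S. \<Sum>j\<in>S. (y i + d) * (y j + d) * c i j)"
    by (simp add: y_def)
  moreover note quad_form_shift[of S c y d, OF sym row' y less_imp_le[OF d]]
  ultimately have "d\<^sup>2 * (card S)\<^sup>2 \<le> d\<^sup>2 * (\<Sum>i\<in>S. \<Sum>j\<in>S. c i j)"
    using eq Qy by linarith
  then have "(card S)\<^sup>2 \<le> (\<Sum>i\<in>S. \<Sum>j\<in>S. c i j)" using d by simp
  then have "(\<Sum>i\<in>S. card S - (\<Sum>j\<in>S. c i j)) \<le> 0"
    by (simp add: sum_subtractf power2_eq_square)
  moreover have "0 \<le> (\<Sum>i\<in>S. card S - (\<Sum>j\<in>S. c i j))"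
    by (intro sum_nonneg) (use row' in simp)
  ultimately have "(\<Sum>i\<in>S. card S - (\<Sum>j\<in>S. c i j)) = 0" by linarith
  then show ?thesis
    using row' k fin by (subst (asm) sum_nonneg_eq_0_iff) auto
qed

section \<open>Commutators with an orthonormal frame of symmetric matrices\<close>

text \<open>A polymorphic copy of \<open>commutator\<close>, whose type is fixed to complex
  entries.\<close>

definition mat_comm :: "'a :: ring mat \<Rightarrow> 'a mat \<Rightarrow> 'a mat" where
  "mat_comm A B = A * B - B * A"

text \<open>The Frobenius inner product, with the size as an explicit argument so that sums can be
  rearranged without carrier conditions.\<close>

definition frob :: "nat \<Rightarrow> real mat \<Rightarrow> real mat \<Rightarrow> real" where
  "frob n A B = (\<Sum>i<n. \<Sum>j<n. A $$ (i, j) * B $$ (i, j))"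

abbreviation cong_mat :: "real mat \<Rightarrow> real mat \<Rightarrow> real mat" where
  "cong_mat Q X \<equiv> transpose_mat Q * X * Q"

lemma mat_comm_carrier:
  "A \<in> carrier_mat n n \<Longrightarrow> B \<in> carrier_mat n n \<Longrightarrow> mat_comm A B \<in> carrier_mat n n"
  by (auto simp: mat_comm_def)

lemma mat_comm_index:
  assumes "A \<in> carrier_mat n n" "B \<in> carrier_mat n n" "i < n" "j < n"
  shows "mat_comm A B $$ (i, j) = (\<Sum>k<n. A $$ (i, k) * B $$ (k, j) - B $$ (i, k) * A $$ (k, j))"
  using assms by (simp add: mat_comm_def scalar_prod_def lessThan_atLeast0 sum_subtractf)

lemma frob_commute: "frob n A B = frob n B A"
  by (simp add: frob_def mult.commute)

lemma frob_nonneg: "0 \<le> frob n A A"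
  by (simp add: frob_def sum_nonneg)

lemma frob_eq_0_iff: "A \<in> carrier_mat n n \<Longrightarrow> frob n A A = 0 \<longleftrightarrow> A = 0\<^sub>m n n"
  by (auto simp: frob_def sum_nonneg_eq_0_iff sum_nonneg intro!: eq_matI)

lemma frob_mat_comm_commute:
  assumes "A \<in> carrier_mat n n" "B \<in> carrier_mat n n"
  shows "frob n (mat_comm A B) (mat_comm A B) = frob n (mat_comm B A) (mat_comm B A)"
  using assms by (simp add: frob_def mat_comm_def algebra_simps)

section \<open>Parseval's identity and invariance under orthogonal congruence\<close>

lemma orthogonal_group_parseval:
  assumes "Q \<in> orthogonal_group n"
  shows "(\<Sum>l<n. (\<Sum>j<n. Q $$ (j, l) * v j) * (\<Sum>j<n. Q $$ (j, l) * u j)) = (\<Sum>j<n. v j * u j)"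
proof -
  have "(\<Sum>l<n. (\<Sum>j<n. Q $$ (j, l) * v j) * (\<Sum>j<n. Q $$ (j, l) * u j)) =
    (\<Sum>l<n. \<Sum>j<n. \<Sum>k<n. Q $$ (j, l) * Q $$ (k, l) * (v j * u k))"
    unfolding sum_product by (intro sum.cong refl) (simp add: mult_ac)
  also have "\<dots> = (\<Sum>j<n. \<Sum>l<n. \<Sum>k<n. Q $$ (j, l) * Q $$ (k, l) * (v j * u k))"
    by (rule sum.swap)
  also have "\<dots> = (\<Sum>j<n. \<Sum>k<n. \<Sum>l<n. Q $$ (j, l) * Q $$ (k, l) * (v j * u k))"
    by (intro sum.cong refl sum.swap)
  also have "\<dots> = (\<Sum>j<n. \<Sum>k<n. (if k = j then 1 else 0) * (v j * u k))"
    using orthogonal_group_rows[OF assms]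
    by (intro sum.cong refl) (auto simp: sum_distrib_right[symmetric])
  finally show ?thesis
    by (simp add: sum_if_eq_mult)
qed

lemma cong_mat_carrier:
  "Q \<in> carrier_mat n n \<Longrightarrow> X \<in> carrier_mat n n \<Longrightarrow> cong_mat Q X \<in> carrier_mat n n"
  by (simp add: mult_carrier_mat[of _ n n _ n])

text \<open>Congruence rotates the row index and the column index, so Parseval's identity is applied
  once for each.\<close>

lemma frob_cong_mat:
  assumes Q: "Q \<in> orthogonal_group n" and X: "X \<in> carrier_mat n n" and Y: "Y \<in> carrier_mat n n"
  shows "frob n (cong_mat Q X) (cong_mat Q Y) = frob n X Y"
proof -
  note Qc = orthogonal_group_carrier[OF Q]
  define x where "x j a = (\<Sum>b<n. Q $$ (b, j) * X $$ (a, b))" for j a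
  define y where "y j a = (\<Sum>b<n. Q $$ (b, j) * Y $$ (a, b))" for j a
  have "frob n (cong_mat Q X) (cong_mat Q Y) =
     (\<Sum>i<n. \<Sum>j<n. (\<Sum>a<n. Q $$ (a, i) * x j a) * (\<Sum>a<n. Q $$ (a, i) * y j a))"
    unfolding frob_def x_def y_def
    by (intro sum.cong refl) (simp only: lessThan_iff conj_index[OF Qc X] conj_index[OF Qc Y])
  also have "\<dots> = (\<Sum>j<n. \<Sum>a<n. x j a * y j a)"
    by (subst sum.swap) (simp add: orthogonal_group_parseval[OF Q])
  also have "\<dots> = (\<Sum>a<n. \<Sum>j<n. x j a * y j a)"
    by (rule sum.swap)
  also have "\<dots> = frob n X Y"
    unfolding frob_def x_def y_def by (simp add: orthogonal_group_parseval[OF Q])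
  finally show ?thesis .
qed

lemma cong_mat_mult:
  assumes Q: "Q \<in> orthogonal_group n" and X: "X \<in> carrier_mat n n" and Y: "Y \<in> carrier_mat n n"
  shows "cong_mat Q X * cong_mat Q Y = cong_mat Q (X * Y)"
proof -
  note Qc = orthogonal_group_carrier[OF Q]
  have "cong_mat Q X * cong_mat Q Y = transpose_mat Q * X * (Q * transpose_mat Q) * Y * Q"
    using Qc X Y by (simp add: assoc_mult_mat[of _ n n _ n _ n])
  also have "\<dots> = cong_mat Q (X * Y)"
    using Qc X Y by (simp add: orthogonal_group_mult_transpose[OF Q] assoc_mult_mat[of _ n n _ n _ n])
  finally show ?thesis .
qed

lemma mat_comm_cong_mat:
  assumes Q: "Q \<in> orthogonal_group n" and X: "X \<in> carrier_mat n n" and Y: "Y \<in> carrier_mat n n"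
  shows "mat_comm (cong_mat Q X) (cong_mat Q Y) = cong_mat Q (mat_comm X Y)"
proof -
  note Qc = orthogonal_group_carrier[OF Q]
  have "cong_mat Q (X * Y - Y * X) = cong_mat Q (X * Y) - cong_mat Q (Y * X)"
    using Qc X Y
    by (simp add: mult_minus_distrib_mat[of _ n n _ n] minus_mult_distrib_mat[of _ n n _ _ n])
  then show ?thesis
    unfolding mat_comm_def cong_mat_mult[OF Q X Y] cong_mat_mult[OF Q Y X] by simp
qed

definition diag_real :: "nat \<Rightarrow> (nat \<Rightarrow> real) \<Rightarrow> real mat" where
  "diag_real n l = mat n n (\<lambda>(i, j). if i = j then l i else 0)"

lemma diag_real_mult:
  assumes X: "X \<in> carrier_mat n n" and ij: "i < n" "j < n"
  shows "(diag_real n l * X) $$ (i, j) = l i * X $$ (i, j)" "(X * diag_real n l) $$ (i, j) = X $$ (i, j) * l j"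
  using assms by (simp_all add: diag_real_def scalar_prod_def if_distrib[of "\<lambda>z. z * _"]
      if_distrib[of "(*) _"] lessThan_atLeast0[symmetric] cong: if_cong)

text \<open>The difference of the two sides is the squared norm of what remains of \<open>g\<close>
  after projection to the span of the family.\<close>

lemma bessel:
  fixes f :: "'a \<Rightarrow> 'x \<Rightarrow> real"
  assumes fin: "finite T" and on: "\<And>a b. a \<in> T \<Longrightarrow> b \<in> T \<Longrightarrow> (\<Sum>x\<in>X. f a x * f b x) = (if a = b then 1 else 0)"
  shows "(\<Sum>a\<in>T. (\<Sum>x\<in>X. f a x * g x)\<^sup>2) \<le> (\<Sum>x\<in>X. (g x)\<^sup>2)"
proof -
  define c where "c a = (\<Sum>x\<in>X. f a x * g x)" for a
  have "(\<Sum>x\<in>X. g x * (\<Sum>a\<in>T. c a * f a x)) = (\<Sum>a\<in>T. c a * c a)"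
    unfolding sum_distrib_left by (subst sum.swap) (simp add: c_def sum_distrib_left mult_ac)
  moreover have "(\<Sum>x\<in>X. (\<Sum>a\<in>T. c a * f a x) * (\<Sum>a\<in>T. c a * f a x)) = (\<Sum>a\<in>T. c a * c a)"
  proof -
    have "(\<Sum>x\<in>X. (\<Sum>a\<in>T. c a * f a x) * (\<Sum>a\<in>T. c a * f a x)) =
      (\<Sum>x\<in>X. \<Sum>a\<in>T. \<Sum>b\<in>T. c a * c b * (f a x * f b x))"
      by (simp add: sum_product mult_ac)
    also have "\<dots> = (\<Sum>a\<in>T. \<Sum>b\<in>T. \<Sum>x\<in>X. c a * c b * (f a x * f b x))"
      by (subst sum.swap) (intro sum.cong refl sum.swap)
    also have "\<dots> = (\<Sum>a\<in>T. \<Sum>b\<in>T. c a * c b * (if a = b then 1 else 0))"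
      by (intro sum.cong refl) (simp add: sum_distrib_left[symmetric] on)
    also have "\<dots> = (\<Sum>a\<in>T. c a * c a)"
      using fin by (simp add: if_distrib[of "(*) _"] cong: if_cong)
    finally show ?thesis .
  qed
  moreover have "0 \<le> (\<Sum>x\<in>X. (g x - (\<Sum>a\<in>T. c a * f a x))\<^sup>2)"
    by (simp add: sum_nonneg)
  moreover have "(\<Sum>x\<in>X. (g x - (\<Sum>a\<in>T. c a * f a x))\<^sup>2) =
     (\<Sum>x\<in>X. (g x)\<^sup>2) - 2 * (\<Sum>x\<in>X. g x * (\<Sum>a\<in>T. c a * f a x))
     + (\<Sum>x\<in>X. (\<Sum>a\<in>T. c a * f a x) * (\<Sum>a\<in>T. c a * f a x))"
    unfolding sum_distrib_left[of 2] sum_subtractf[symmetric] sum.distrib[symmetric]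
    by (intro sum.cong refl) (simp add: power2_eq_square algebra_simps)
  ultimately have "(\<Sum>a\<in>T. c a * c a) \<le> (\<Sum>x\<in>X. (g x)\<^sup>2)" by linarith
  then show ?thesis
    by (simp only: c_def power2_eq_square)
qed

section \<open>The weighted graph of an orthonormal frame\<close>

locale orthonormal_frame =
  fixes n :: nat and T :: "'a set" and F :: "'a \<Rightarrow> real mat"
  assumes fin: "finite T"
    and carrier: "a \<in> T \<Longrightarrow> F a \<in> carrier_mat n n"
    and symm: "a \<in> T \<Longrightarrow> transpose_mat (F a) = F a"
    and orthonormal: "a \<in> T \<Longrightarrow> b \<in> T \<Longrightarrow> frob n (F a) (F b) = (if a = b then 1 else 0)"
begin

text \<open>The factor 2 collects the two mirror positions of a symmetric matrix. The diagonal is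
  cut off because loops carry no energy.\<close>

definition "weight u v = (if u = v then 0 else 2 * (\<Sum>a\<in>T. (F a $$ (u, v))\<^sup>2))"

lemma F_sym: "a \<in> T \<Longrightarrow> u < n \<Longrightarrow> v < n \<Longrightarrow> F a $$ (u, v) = F a $$ (v, u)"
  by (rule symmetric_mat_index[OF carrier symm])

text \<open>The squared entries of each \<open>F a\<close> add up to 1 and are split into edge
  weight and diagonal. Keeping the diagonal part visible lets a tight total weight force zero
  diagonals later.\<close>

lemma weight_total:
  "(\<Sum>u<n. \<Sum>v<n. weight u v) + 2 * (\<Sum>a\<in>T. \<Sum>u<n. (F a $$ (u, u))\<^sup>2) = 2 * card T"
proof -
  have "(\<Sum>a\<in>T. \<Sum>u<n. (F a $$ (u, u))\<^sup>2) = (\<Sum>u<n. \<Sum>a\<in>T. (F a $$ (u, u))\<^sup>2)"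
    by (rule sum.swap)
  also have "2 * \<dots> = (\<Sum>u<n. \<Sum>v<n. if v = u then 2 * (\<Sum>a\<in>T. (F a $$ (u, v))\<^sup>2) else 0)"
    by (simp add: sum_distrib_left)
  finally have "(\<Sum>u<n. \<Sum>v<n. weight u v) + 2 * (\<Sum>a\<in>T. \<Sum>u<n. (F a $$ (u, u))\<^sup>2) =
      (\<Sum>u<n. \<Sum>v<n. weight u v + (if v = u then 2 * (\<Sum>a\<in>T. (F a $$ (u, v))\<^sup>2) else 0))"
    by (simp only: sum.distrib)
  also have "\<dots> = (\<Sum>u<n. \<Sum>v<n. \<Sum>a\<in>T. 2 * (F a $$ (u, v))\<^sup>2)"
    unfolding weight_def by (intro sum.cong refl) (simp add: sum_distrib_left)
  also have "\<dots> = (\<Sum>u<n. \<Sum>a\<in>T. \<Sum>v<n. 2 * (F a $$ (u, v))\<^sup>2)"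
    by (intro sum.cong refl sum.swap)
  also have "\<dots> = (\<Sum>a\<in>T. \<Sum>u<n. \<Sum>v<n. 2 * (F a $$ (u, v))\<^sup>2)"
    by (rule sum.swap)
  also have "\<dots> = (\<Sum>a\<in>T. 2 * frob n (F a) (F a))"
    by (simp only: frob_def power2_eq_square sum_distrib_left)
  finally show ?thesis by (simp add: orthonormal)
qed

text \<open>Bessel's inequality for the indicator \<open>g\<close> of the two mirror positions: its
  squared norm is 2 and every coefficient is twice an entry.\<close>

lemma weight_le_1:
  assumes uv: "u < n" "v < n"
  shows "weight u v \<le> 1"
proof (cases "u = v")
  case False
  let ?X = "{..<n} \<times> {..<n}" and ?D = "{(u, v), (v, u)}"
  define g :: "nat \<times> nat \<Rightarrow> real" where "g x = (if x \<in> ?D then 1 else 0)" for x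
  have D: "?D \<subseteq> ?X" using uv by auto
  have g: "(\<Sum>x\<in>?X. h x * g x) = (\<Sum>x\<in>?D. h x)" for h :: "nat \<times> nat \<Rightarrow> real"
  proof -
    have "(\<Sum>x\<in>?X. h x * g x) = (\<Sum>x\<in>?D. h x * g x)"
      using D by (intro sum.mono_neutral_right) (auto simp: g_def)
    then show ?thesis by (simp add: g_def)
  qed
  have "(\<Sum>a\<in>T. (\<Sum>x\<in>?X. F a $$ x * g x)\<^sup>2) \<le> (\<Sum>x\<in>?X. (g x)\<^sup>2)"
    by (rule bessel[OF fin]) (simp add: orthonormal[symmetric] frob_def sum.cartesian_product)
  moreover have "(\<Sum>x\<in>?X. (g x)\<^sup>2) = 2"
    unfolding power2_eq_square g using False by (simp add: g_def)
  moreover have "(\<Sum>x\<in>?X. F a $$ x * g x) = 2 * F a $$ (u, v)" if "a \<in> T" for a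
    unfolding g using False F_sym[OF that uv] by simp
  ultimately have "(\<Sum>a\<in>T. (2 * F a $$ (u, v))\<^sup>2) \<le> 2" by simp
  then show ?thesis
    using False by (simp add: weight_def power_mult_distrib sum_distrib_left[symmetric])
qed (simp add: weight_def)

lemma weight_weighted_graph: "weighted_graph {..<n} weight (card T)"
proof
  have "0 \<le> (\<Sum>a\<in>T. \<Sum>u<n. (F a $$ (u, u))\<^sup>2)"
    by (simp add: sum_nonneg)
  with weight_total show "(\<Sum>u<n. \<Sum>v<n. weight u v) \<le> 2 * real (card T)"
    by linarith
  show "weight u v = weight v u" if "u \<in> {..<n}" "v \<in> {..<n}" for u v
    unfolding weight_def using that F_sym[of _ u v] by (auto intro!: sum.cong)
  show "weight u v \<le> 1" if "u \<in> {..<n}" "v \<in> {..<n}" for u v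
    using that by (intro weight_le_1) auto
qed (simp_all add: weight_def sum_nonneg)

text \<open>\<open>l\<close> stays a parameter: the frame determines the graph, while the potential
  comes from the spectrum of a further matrix.\<close>

sublocale weighted_graph "{..<n}" weight "real (card T)" l for l :: "nat \<Rightarrow> real"
  by (rule weight_weighted_graph)

text \<open>The commutator with a diagonal matrix multiplies the entry at \<open>(u, v)\<close> by
  \<open>l u - l v\<close>.\<close>

lemma energy_eq_comm:
  "energy l = (\<Sum>a\<in>T. frob n (mat_comm (diag_real n l) (F a)) (mat_comm (diag_real n l) (F a)))"
proof -
  have D: "diag_real n l \<in> carrier_mat n n" by (simp add: diag_real_def)
  have "frob n (mat_comm (diag_real n l) (F a)) (mat_comm (diag_real n l) (F a)) =
     (\<Sum>u<n. \<Sum>v<n. (F a $$ (u, v))\<^sup>2 * (l u - l v)\<^sup>2)" if a: "a \<in> T" for a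
    unfolding frob_def
  proof (intro sum.cong refl)
    fix u v assume uv: "u \<in> {..<n}" "v \<in> {..<n}"
    have "mat_comm (diag_real n l) (F a) $$ (u, v) = F a $$ (u, v) * (l u - l v)"
      using D carrier[OF a] uv
      by (simp add: mat_comm_def diag_real_mult algebra_simps del: index_mult_mat(1))
    then show "mat_comm (diag_real n l) (F a) $$ (u, v) * mat_comm (diag_real n l) (F a) $$ (u, v) =
        (F a $$ (u, v))\<^sup>2 * (l u - l v)\<^sup>2"
      by (simp add: power2_eq_square mult_ac)
  qed
  then have "(\<Sum>a\<in>T. frob n (mat_comm (diag_real n l) (F a)) (mat_comm (diag_real n l) (F a))) =
     (\<Sum>a\<in>T. \<Sum>u<n. \<Sum>v<n. (F a $$ (u, v))\<^sup>2 * (l u - l v)\<^sup>2)" by simp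
  also have "\<dots> = (\<Sum>u<n. \<Sum>v<n. \<Sum>a\<in>T. (F a $$ (u, v))\<^sup>2 * (l u - l v)\<^sup>2)"
    by (subst sum.swap) (intro sum.cong refl sum.swap)
  also have "\<dots> = (\<Sum>u<n. \<Sum>v<n. weight u v * (l u - l v)\<^sup>2 / 2)"
    by (intro sum.cong refl) (simp add: weight_def sum_distrib_right[symmetric])
  also have "\<dots> = energy l"
    by (simp add: energy_def sum_divide_distrib)
  finally show ?thesis by simp
qed

end

section \<open>Frames in the eigenbasis of a unit matrix\<close>

lemma orthonormal_frame_cong_mat:
  assumes P: "P \<in> orthogonal_group n" and E: "orthonormal_frame n T E"
  shows "orthonormal_frame n T (\<lambda>a. cong_mat P (E a))"
proof -
  interpret orthonormal_frame n T E by (rule E)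
  show ?thesis
    using orthogonal_group_carrier[OF P]
    by unfold_locales
      (simp_all add: fin carrier symm orthonormal cong_mat_carrier transpose_conj frob_cong_mat[OF P])
qed

lemma frob_mat_comm_cong_mat:
  assumes P: "P \<in> orthogonal_group n" and X: "X \<in> carrier_mat n n" and Y: "Y \<in> carrier_mat n n"
  shows "frob n (mat_comm (cong_mat P X) (cong_mat P Y)) (mat_comm (cong_mat P X) (cong_mat P Y)) =
    frob n (mat_comm X Y) (mat_comm X Y)"
  unfolding mat_comm_cong_mat[OF assms]
  by (intro frob_cong_mat P mat_comm_carrier X Y)

lemma frob_cube_cong_mat:
  assumes P: "P \<in> orthogonal_group n" and X: "X \<in> carrier_mat n n"
  shows "frob n (cong_mat P X * cong_mat P X) (cong_mat P X) = frob n (X * X) X"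
  unfolding cong_mat_mult[OF P X X] by (intro frob_cong_mat P mult_carrier_mat[OF X X] X)

lemma frob_diag_real: "frob n (diag_real n l) (diag_real n l) = (\<Sum>u<n. (l u)\<^sup>2)"
  by (simp add: frob_def diag_real_def power2_eq_square if_distrib[of "\<lambda>z. z * _"] cong: if_cong)

lemma frob_diag_real_cube: "frob n (diag_real n l * diag_real n l) (diag_real n l) = (\<Sum>u<n. (l u) ^ 3)"
proof -
  have D: "diag_real n l \<in> carrier_mat n n" by (simp add: diag_real_def)
  have "frob n (diag_real n l * diag_real n l) (diag_real n l) =
     (\<Sum>u<n. \<Sum>v<n. l u * diag_real n l $$ (u, v) * diag_real n l $$ (u, v))"
    unfolding frob_def by (intro sum.cong refl) (simp only: lessThan_iff diag_real_mult(1)[OF D])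
  then show ?thesis
    by (simp add: diag_real_def power3_eq_cube mult.assoc if_distrib[of "\<lambda>z. z * _"]
        if_distrib[of "(*) _"] cong: if_cong)
qed

text \<open>Every summand belongs to a triangle \<open>x\<close>, \<open>z\<close>,
  \<open>y\<close>, and a star without loops has no triangles. For symmetric \<open>X\<close> the
  value is the trace of the cube.\<close>

lemma frob_cube_star:
  assumes X: "X \<in> carrier_mat n n"
    and star: "\<forall>x<n. \<forall>y<n. x = y \<or> x \<noteq> u \<and> y \<noteq> u \<longrightarrow> X $$ (x, y) = 0"
  shows "frob n (X * X) X = 0"
proof -
  have "frob n (X * X) X = (\<Sum>x<n. \<Sum>y<n. (\<Sum>z<n. X $$ (x, z) * X $$ (z, y)) * X $$ (x, y))"
    unfolding frob_def using X
    by (intro sum.cong refl) (simp add: scalar_prod_def lessThan_atLeast0)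
  also have "\<dots> = 0"
    unfolding sum_distrib_right
  proof (intro sum.neutral ballI)
    fix x y z assume "x \<in> {..<n}" "y \<in> {..<n}" "z \<in> {..<n}"
    then have "X $$ (x, z) = 0 \<or> X $$ (z, y) = 0 \<or> X $$ (x, y) = 0"
      using star by (metis lessThan_iff)
    then show "X $$ (x, z) * X $$ (z, y) * X $$ (x, y) = 0" by auto
  qed
  finally show ?thesis .
qed

text \<open>In use, \<open>A\<close> is one member of an orthonormal family and \<open>E\<close>
  runs through the others, so that \<open>card T + 1\<close> is the size of the whole
  family.\<close>

locale framed_matrix = orthonormal_frame n T E for n and T :: "'a set" and E +
  fixes A :: "real mat"
  assumes A: "A \<in> carrier_mat n n" "transpose_mat A = A" "frob n A A = 1"
begin

text \<open>An eigenbasis of \<open>A\<close> rotates the frame as well. By orthogonal invariance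
  the commutator sum becomes the energy of the spectrum on the graph of the rotated frame.\<close>

lemma diagonalize:
  obtains P and l :: "nat \<Rightarrow> real" where "P \<in> orthogonal_group n" "cong_mat P A = diag_real n l" "(\<Sum>u<n. (l u)\<^sup>2) = 1"
    "orthonormal_frame n T (\<lambda>a. cong_mat P (E a))"
    "weighted_graph.energy {..<n} (orthonormal_frame.weight T (\<lambda>a. cong_mat P (E a))) l =
       (\<Sum>a\<in>T. frob n (mat_comm A (E a)) (mat_comm A (E a)))"
proof -
  obtain P l where P: "P \<in> orthogonal_group n" and l: "cong_mat P A = diag_real n l"
    using real_spectral[OF A(1,2)] unfolding diag_real_def by blast
  have fr: "orthonormal_frame n T (\<lambda>a. cong_mat P (E a))"
    by (rule orthonormal_frame_cong_mat[OF P orthonormal_frame_axioms])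
  interpret F: orthonormal_frame n T "\<lambda>a. cong_mat P (E a)" by (rule fr)
  have "F.energy l = (\<Sum>a\<in>T. frob n (mat_comm A (E a)) (mat_comm A (E a)))"
    unfolding F.energy_eq_comm l[symmetric]
    by (intro sum.cong refl frob_mat_comm_cong_mat P A carrier)
  moreover have "(\<Sum>u<n. (l u)\<^sup>2) = 1"
    unfolding frob_diag_real[symmetric] l[symmetric] using frob_cong_mat[OF P A(1) A(1)] A(3) by simp
  ultimately show thesis using that P l fr by blast
qed

theorem comm_frame_le: "(\<Sum>a\<in>T. frob n (mat_comm A (E a)) (mat_comm A (E a))) \<le> card T + 1"
proof -
  obtain P and l :: "nat \<Rightarrow> real" where *: "P \<in> orthogonal_group n" "cong_mat P A = diag_real n l" "(\<Sum>u<n. (l u)\<^sup>2) = 1"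
    "orthonormal_frame n T (\<lambda>a. cong_mat P (E a))"
    "weighted_graph.energy {..<n} (orthonormal_frame.weight T (\<lambda>a. cong_mat P (E a))) l =
       (\<Sum>a\<in>T. frob n (mat_comm A (E a)) (mat_comm A (E a)))"
    by (rule diagonalize)
  interpret F: orthonormal_frame n T "\<lambda>a. cong_mat P (E a)" by (rule *(4))
  show ?thesis using F.energy_le[of l] *(3,5) by simp
qed

text \<open>The star of \<open>energy_eq_imp_star\<close> read off as matrix entries:
  \<open>u\<close> is its centre and \<open>v\<close> a leaf joined to it with weight 1. The clause
  for \<open>card T = 1\<close> serves the final normal form.\<close>

lemma comm_frame_eqE:
  assumes eq: "(\<Sum>a\<in>T. frob n (mat_comm A (E a)) (mat_comm A (E a))) = card T + 1"
  obtains P and l :: "nat \<Rightarrow> real" and u v where "P \<in> orthogonal_group n" "cong_mat P A = diag_real n l" "(\<Sum>x<n. (l x)\<^sup>2) = 1"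
    "u < n" "v < n" "u \<noteq> v" "l v \<noteq> 0" "l u = - real (card T) * l v" "(\<Sum>x<n. l x) = 0"
    "\<forall>x<n. x \<noteq> u \<longrightarrow> l x = 0 \<or> l x = l v"
    "card T = 1 \<longrightarrow> (\<forall>x<n. x \<noteq> u \<longrightarrow> x \<noteq> v \<longrightarrow> l x = 0)"
    "\<forall>a\<in>T. \<forall>x<n. \<forall>y<n. x = y \<or> x \<noteq> u \<and> y \<noteq> u \<longrightarrow> cong_mat P (E a) $$ (x, y) = 0"
    "2 * (\<Sum>a\<in>T. (cong_mat P (E a) $$ (u, v))\<^sup>2) = 1"
proof -
  obtain P and l :: "nat \<Rightarrow> real" where *: "P \<in> orthogonal_group n" "cong_mat P A = diag_real n l" "(\<Sum>u<n. (l u)\<^sup>2) = 1"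
    "orthonormal_frame n T (\<lambda>a. cong_mat P (E a))"
    "weighted_graph.energy {..<n} (orthonormal_frame.weight T (\<lambda>a. cong_mat P (E a))) l =
       (\<Sum>a\<in>T. frob n (mat_comm A (E a)) (mat_comm A (E a)))"
    by (rule diagonalize)
  interpret F: orthonormal_frame n T "\<lambda>a. cong_mat P (E a)" by (rule *(4))
  have en: "F.energy l = (real (card T) + 1) * (\<Sum>u<n. (l u)\<^sup>2)" "0 < (\<Sum>u<n. (l u)\<^sup>2)"
    using *(3,5) eq by simp_all
  obtain u v where uv: "u \<in> {..<n}" "v \<in> {..<n}" "u \<noteq> v" "l v \<noteq> 0" "l u = - real (card T) * l v" "F.weight u v = 1"
    and lx: "\<And>x. x \<in> {..<n} \<Longrightarrow> x \<noteq> u \<Longrightarrow> l x = 0 \<or> l x = l v"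
    and star: "\<And>x y. x \<in> {..<n} \<Longrightarrow> y \<in> {..<n} \<Longrightarrow> x \<noteq> u \<Longrightarrow> y \<noteq> u \<Longrightarrow> F.weight x y = 0"
    and sum_l: "(\<Sum>x<n. l x) = 0" and total: "(\<Sum>x<n. \<Sum>y<n. F.weight x y) = 2 * real (card T)"
    and isolated: "\<And>x. x \<in> {..<n} \<Longrightarrow> x \<noteq> u \<Longrightarrow> F.weight x u = 0 \<Longrightarrow> l x = 0"
    and deg_u: "(\<Sum>x<n. F.weight u x) = card T"
    by (rule F.energy_eq_imp_star[OF en], rule that; (assumption | blast))
  \<comment> \<open>A tight total weight leaves nothing for the diagonal part of
    \<open>weight_total\<close>.\<close>
  have diag: "cong_mat P (E a) $$ (x, x) = 0" if "a \<in> T" "x < n" for a x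
  proof -
    have "(\<Sum>a\<in>T. \<Sum>x<n. (cong_mat P (E a) $$ (x, x))\<^sup>2) = 0"
      using F.weight_total total by linarith
    with that fin show ?thesis
      by (simp add: sum_nonneg_eq_0_iff sum_nonneg del: index_mult_mat)
  qed
  have off: "cong_mat P (E a) $$ (x, y) = 0" if "a \<in> T" "x < n" "y < n" "x \<noteq> u" "y \<noteq> u" "x \<noteq> y" for a x y
    using star[of x y] that fin
    by (simp add: F.weight_def sum_nonneg_eq_0_iff del: index_mult_mat)
  \<comment> \<open>The centre has degree 1 here, used up by the edge to \<open>v\<close>, so no
    other vertex is joined to it.\<close>
  have pend: "l x = 0" if "card T = 1" "x < n" "x \<noteq> u" "x \<noteq> v" for x
  proof -
    have "(\<Sum>y\<in>{..<n} - {v}. F.weight u y) = 0"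
      using deg_u uv(2,6) that(1) by (simp add: sum.remove[of _ v])
    then have "F.weight u x = 0"
      using that uv(1) F.w_nonneg[of u] by (subst (asm) sum_nonneg_eq_0_iff) auto
    with isolated[of x] that uv(1) F.w_sym[of u x] show ?thesis by simp
  qed
  have "2 * (\<Sum>a\<in>T. (cong_mat P (E a) $$ (u, v))\<^sup>2) = 1"
    using uv(3,6) by (simp add: F.weight_def del: index_mult_mat)
  moreover have "\<forall>a\<in>T. \<forall>x<n. \<forall>y<n. x = y \<or> x \<noteq> u \<and> y \<noteq> u \<longrightarrow> cong_mat P (E a) $$ (x, y) = 0"
    using diag off by blast
  moreover have "\<forall>x<n. x \<noteq> u \<longrightarrow> l x = 0 \<or> l x = l v"
    using lx by simp
  moreover have "card T = 1 \<longrightarrow> (\<forall>x<n. x \<noteq> u \<longrightarrow> x \<noteq> v \<longrightarrow> l x = 0)"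
    using pend by blast
  moreover have "u < n" "v < n" using uv(1,2) by simp_all
  ultimately show thesis
    by (intro that[OF *(1-3) _ _ uv(3-5) sum_l])
qed

text \<open>Write N for \<open>card T\<close>. The spectrum of \<open>A\<close> sums to zero, has
  \<open>- N * l v\<close> at the centre and 0 or \<open>l v\<close> elsewhere, so its cubes sum to
  \<open>N * (1 - N\<^sup>2) * l v ^ 3\<close>. The frame matrices live on a star.\<close>

lemma comm_frame_eq_imp_cubes:
  assumes eq: "(\<Sum>a\<in>T. frob n (mat_comm A (E a)) (mat_comm A (E a))) = card T + 1"
  shows "card T \<ge> 2 \<Longrightarrow> frob n (A * A) A \<noteq> 0" and "a \<in> T \<Longrightarrow> frob n (E a * E a) (E a) = 0"
proof -
  obtain P and l :: "nat \<Rightarrow> real" and u v where P: "P \<in> orthogonal_group n" "cong_mat P A = diag_real n l"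
    and "(\<Sum>x<n. (l x)\<^sup>2) = 1"
    and uv: "u < n" "v < n" "u \<noteq> v" "l v \<noteq> 0" "l u = - real (card T) * l v" and sum_l: "(\<Sum>x<n. l x) = 0"
    and lx: "\<forall>x<n. x \<noteq> u \<longrightarrow> l x = 0 \<or> l x = l v"
    and "card T = 1 \<longrightarrow> (\<forall>x<n. x \<noteq> u \<longrightarrow> x \<noteq> v \<longrightarrow> l x = 0)"
    and star: "\<forall>a\<in>T. \<forall>x<n. \<forall>y<n. x = y \<or> x \<noteq> u \<and> y \<noteq> u \<longrightarrow> cong_mat P (E a) $$ (x, y) = 0"
    and "2 * (\<Sum>a\<in>T. (cong_mat P (E a) $$ (u, v))\<^sup>2) = 1"
    by (rule comm_frame_eqE[OF eq], rule that)
  have split: "(\<Sum>x<n. f x) = f u + (\<Sum>x\<in>{..<n}-{u}. f x)" for f :: "nat \<Rightarrow> real"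
    using uv by (simp add: sum.remove)
  {
    assume N: "card T \<ge> 2"
    \<comment> \<open>Away from the centre, cubing a value amounts to multiplying it by
      \<open>(l v)\<^sup>2\<close>.\<close>
    have "(\<Sum>x\<in>{..<n}-{u}. l x ^ 3) = (l v)\<^sup>2 * (\<Sum>x\<in>{..<n}-{u}. l x)"
      unfolding sum_distrib_left using lx
      by (intro sum.cong refl) (force simp: power3_eq_cube power2_eq_square)
    also have "(\<Sum>x\<in>{..<n}-{u}. l x) = - l u"
      using sum_l split[of l] by simp
    finally have "(\<Sum>x<n. l x ^ 3) = real (card T) * (1 - (real (card T))\<^sup>2) * l v ^ 3"
      unfolding split[of "\<lambda>x. l x ^ 3"] uv(5)
      by (simp add: power2_eq_square power3_eq_cube algebra_simps)
    moreover have "1 - (real (card T))\<^sup>2 \<noteq> 0"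
      using N by (simp add: power2_eq_1_iff)
    ultimately have "(\<Sum>x<n. l x ^ 3) \<noteq> 0" using uv N by simp
    then show "frob n (A * A) A \<noteq> 0"
      using frob_diag_real_cube[of n l] frob_cube_cong_mat[OF P(1) A(1)] P(2) by simp
  }
  assume a: "a \<in> T"
  have Fc: "cong_mat P (E a) \<in> carrier_mat n n"
    by (rule cong_mat_carrier[OF orthogonal_group_carrier[OF P(1)] carrier[OF a]])
  have "frob n (cong_mat P (E a) * cong_mat P (E a)) (cong_mat P (E a)) = 0"
    using star a by (intro frob_cube_star[OF Fc, of u]) blast
  then show "frob n (E a * E a) (E a) = 0"
    unfolding frob_cube_cong_mat[OF P(1) carrier[OF a]] .
qed

end

section \<open>Normal form of an extremal pair\<close>

text \<open>\<open>H1_real\<close> and \<open>H2_real\<close> are the real counterparts of the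
  padded blocks \<open>diag_zero n (H1 t)\<close> and \<open>diag_zero n (H2 t)\<close>, which
  require \<open>n \<ge> 2\<close> to match.\<close>

definition H1_real :: "nat \<Rightarrow> real \<Rightarrow> real mat" where
  "H1_real n t = mat n n (\<lambda>(i, j). if i = 0 \<and> j = 0 then t else if i = 1 \<and> j = 1 then - t else 0)"

definition H2_real :: "nat \<Rightarrow> real \<Rightarrow> real mat" where
  "H2_real n t = mat n n (\<lambda>(i, j). if i = 0 \<and> j = 1 \<or> i = 1 \<and> j = 0 then t else 0)"

lemma ex_permutes_two:
  assumes "u < n" "v < n" "u \<noteq> v"
  obtains p where "p permutes {..<n}" "p 0 = u" "p 1 = (v :: nat)"
proof -
  \<comment> \<open>\<open>v'\<close> is the point that the outer transposition sends to
    \<open>v\<close>; as it differs from 0, the inner transposition does not disturb 0.\<close>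
  define v' where "v' = Transposition.transpose 0 u v"
  have v': "v' < n" "v' \<noteq> 0"
    using assms by (auto simp: v'_def Transposition.transpose_def)
  have "Transposition.transpose 0 u \<circ> Transposition.transpose 1 v' permutes {..<n}"
    using assms v' by (intro permutes_compose permutes_swap_id) auto
  moreover have "(Transposition.transpose 0 u \<circ> Transposition.transpose 1 v') 0 = u"
    using v' by (simp add: Transposition.transpose_def)
  moreover have "(Transposition.transpose 0 u \<circ> Transposition.transpose 1 v') 1 = v"
    by (simp add: v'_def)
  ultimately show thesis using that by blast
qed

text \<open>Used twice: with signs to normalise the entries of an extremal pair, and with all signs
  1 to reorder the members of a rotated family.\<close>

lemma signed_permutation_of_cols:
  fixes s :: "nat \<Rightarrow> real"
  assumes P: "P \<in> orthogonal_group n" and p: "p permutes {..<n}" and s: "\<And>i. (s i)\<^sup>2 = 1"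
  defines "Q \<equiv> mat n n (\<lambda>(x, i). s i * P $$ (x, p i))"
  shows "Q \<in> orthogonal_group n"
    and "X \<in> carrier_mat n n \<Longrightarrow> i < n \<Longrightarrow> j < n \<Longrightarrow>
      cong_mat Q X $$ (i, j) = s i * s j * cong_mat P X $$ (p i, p j)"
proof -
  have Q: "Q \<in> carrier_mat n n" by (simp add: Q_def)
  have pn: "p i < n" if "i < n" for i
    using permutes_in_image[OF p, of i] that by simp
  show "Q \<in> orthogonal_group n"
  proof (rule orthogonal_groupI[OF Q])
    fix i j assume ij: "i < n" "j < n"
    have "(\<Sum>x<n. Q $$ (x, i) * Q $$ (x, j)) = s i * s j * (\<Sum>x<n. P $$ (x, p i) * P $$ (x, p j))"
      unfolding sum_distrib_left using ij by (intro sum.cong refl) (simp add: Q_def)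
    also have "\<dots> = (if i = j then 1 else 0)"
      using orthogonal_group_cols[OF P pn pn, OF ij] s[of i] permutes_inj[OF p]
      by (auto simp: power2_eq_square dest: injD)
    finally show "(\<Sum>x<n. Q $$ (x, i) * Q $$ (x, j)) = (if i = j then 1 else 0)" .
  qed
  assume X: "X \<in> carrier_mat n n" and ij: "i < n" "j < n"
  show "cong_mat Q X $$ (i, j) = s i * s j * cong_mat P X $$ (p i, p j)"
    unfolding conj_index[OF Q X ij] conj_index[OF orthogonal_group_carrier[OF P] X pn[OF ij(1)] pn[OF ij(2)]]
      sum_distrib_left
    using ij by (intro sum.cong refl) (simp add: Q_def)
qed

lemma normal_form_pair:
  assumes P: "P \<in> orthogonal_group n" and A: "A \<in> carrier_mat n n" and F: "F \<in> carrier_mat n n"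
    and uv: "u < n" "v < n" "u \<noteq> v" and t: "t > 0"
    and diag: "\<And>x y. x < n \<Longrightarrow> y < n \<Longrightarrow> cong_mat P A $$ (x, y) =
        (if x = u \<and> y = u then t else if x = v \<and> y = v then - t else 0)"
    and off: "\<And>x y. x < n \<Longrightarrow> y < n \<Longrightarrow> cong_mat P F $$ (x, y) =
        (if x = u \<and> y = v \<or> x = v \<and> y = u then e * t else 0)"
    and e: "e = 1 \<or> e = - 1"
  shows "\<exists>Q\<in>orthogonal_group n. cong_mat Q A = H1_real n t \<and> cong_mat Q F = H2_real n t"
proof -
  obtain p where p: "p permutes {..<n}" "p 0 = u" "p 1 = v"
    by (rule ex_permutes_two[OF uv])
  \<comment> \<open>Flipping column 1 absorbs the sign \<open>e\<close> of the off-diagonal entry;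
    diagonal entries only see the square of a sign.\<close>
  define s where "s i = (if i = 1 then e else 1)" for i :: nat
  have s: "(s i)\<^sup>2 = 1" for i using e by (auto simp: s_def)
  define Q where "Q = mat n n (\<lambda>(x, i). s i * P $$ (x, p i))"
  have Q: "Q \<in> orthogonal_group n"
    "\<And>X i j. X \<in> carrier_mat n n \<Longrightarrow> i < n \<Longrightarrow> j < n \<Longrightarrow>
      cong_mat Q X $$ (i, j) = s i * s j * cong_mat P X $$ (p i, p j)"
    unfolding Q_def by (rule signed_permutation_of_cols[OF P p(1) s]; assumption)+
  note Qc = orthogonal_group_carrier[OF Q(1)]
  have pn: "p i < n" if "i < n" for i
    using permutes_in_image[OF p(1), of i] that by simp
  have pu: "p i = u \<longleftrightarrow> i = 0" and pv: "p i = v \<longleftrightarrow> i = 1" for i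
    using permutes_inj[OF p(1)] p(2,3) by (metis injD)+
  have "cong_mat Q A = H1_real n t"
  proof (rule eq_matI)
    fix i j assume "i < dim_row (H1_real n t)" "j < dim_col (H1_real n t)"
    then have ij: "i < n" "j < n" by (simp_all add: H1_real_def)
    have "cong_mat Q A $$ (i, j) = s i * s j * (if i = 0 \<and> j = 0 then t else if i = 1 \<and> j = 1 then - t else 0)"
      by (simp only: Q(2)[OF A ij] diag[OF pn[OF ij(1)] pn[OF ij(2)]] pu pv)
    then show "cong_mat Q A $$ (i, j) = H1_real n t $$ (i, j)"
      using ij e by (auto simp: H1_real_def s_def)
  qed (use Qc A in \<open>simp_all add: H1_real_def\<close>)
  moreover have "cong_mat Q F = H2_real n t"
  proof (rule eq_matI)
    fix i j assume "i < dim_row (H2_real n t)" "j < dim_col (H2_real n t)"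
    then have ij: "i < n" "j < n" by (simp_all add: H2_real_def)
    have "cong_mat Q F $$ (i, j) = s i * s j * (if i = 0 \<and> j = 1 \<or> i = 1 \<and> j = 0 then e * t else 0)"
      by (simp only: Q(2)[OF F ij] off[OF pn[OF ij(1)] pn[OF ij(2)]] pu pv)
    then show "cong_mat Q F $$ (i, j) = H2_real n t $$ (i, j)"
      using ij e by (auto simp: H2_real_def s_def)
  qed (use Qc F in \<open>simp_all add: H2_real_def\<close>)
  ultimately show ?thesis using Q(1) by blast
qed

context framed_matrix
begin

text \<open>The star is a single edge: the spectrum of \<open>A\<close> is reduced to two opposite
  values, and the two entries of \<open>E c\<close> on the edge exhaust its norm.\<close>

lemma comm_pair_eq_imp_normal_form:
  assumes T: "T = {c}" and eq: "frob n (mat_comm A (E c)) (mat_comm A (E c)) = 2"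
  shows "\<exists>Q\<in>orthogonal_group n. cong_mat Q A = H1_real n (1 / sqrt 2) \<and> cong_mat Q (E c) = H2_real n (1 / sqrt 2)"
proof -
  have eq': "(\<Sum>a\<in>T. frob n (mat_comm A (E a)) (mat_comm A (E a))) = card T + 1"
    using T eq by simp
  obtain P and l :: "nat \<Rightarrow> real" and u v where P: "P \<in> orthogonal_group n" "cong_mat P A = diag_real n l"
    and l1: "(\<Sum>x<n. (l x)\<^sup>2) = 1"
    and uv: "u < n" "v < n" "u \<noteq> v" "l v \<noteq> 0" "l u = - real (card T) * l v" and sum_l: "(\<Sum>x<n. l x) = 0"
    and lx: "\<forall>x<n. x \<noteq> u \<longrightarrow> l x = 0 \<or> l x = l v"
    and l0: "card T = 1 \<longrightarrow> (\<forall>x<n. x \<noteq> u \<longrightarrow> x \<noteq> v \<longrightarrow> l x = 0)"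
    and star: "\<forall>a\<in>T. \<forall>x<n. \<forall>y<n. x = y \<or> x \<noteq> u \<and> y \<noteq> u \<longrightarrow> cong_mat P (E a) $$ (x, y) = 0"
    and w: "2 * (\<Sum>a\<in>T. (cong_mat P (E a) $$ (u, v))\<^sup>2) = 1"
    by (rule comm_frame_eqE[OF eq'], rule that)
  have Ec: "E c \<in> carrier_mat n n" "transpose_mat (E c) = E c" and E1: "frob n (E c) (E c) = 1"
    using carrier symm orthonormal T by simp_all
  define G where "G = cong_mat P (E c)"
  have Gc: "G \<in> carrier_mat n n" "transpose_mat G = G"
    using transpose_conj[OF orthogonal_group_carrier[OF P(1)] Ec(1)]
      cong_mat_carrier[OF orthogonal_group_carrier[OF P(1)] Ec(1)] by (simp_all add: G_def Ec(2))
  note G_sym = symmetric_mat_index[OF Gc]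
  have G1: "frob n G G = 1"
    unfolding G_def using frob_cong_mat[OF P(1) Ec(1) Ec(1)] E1 by simp
  have Gstar: "G $$ (x, y) = 0" if "x < n" "y < n" "x = y \<or> x \<noteq> u \<and> y \<noteq> u" for x y
    using star that T unfolding G_def by blast
  have Guv: "(G $$ (u, v))\<^sup>2 = 1 / 2"
    using w T by (simp add: G_def[symmetric])
  have Gu: "G $$ (u, y) = 0" if y: "y < n" "y \<noteq> v" for y
  proof (cases "y = u")
    case False
    \<comment> \<open>The first two positions already carry the full squared norm 1, so the third
      entry must vanish.\<close>
    let ?D = "{(u, v), (v, u), (u, y)}"
    have "(\<Sum>x\<in>?D. (G $$ x)\<^sup>2) \<le> (\<Sum>x\<in>{..<n} \<times> {..<n}. (G $$ x)\<^sup>2)"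
      using uv y by (intro sum_mono2) auto
    also have "\<dots> = 1"
      using G1 by (simp add: frob_def sum.cartesian_product power2_eq_square)
    finally have "(G $$ (u, v))\<^sup>2 + (G $$ (v, u))\<^sup>2 + (G $$ (u, y))\<^sup>2 \<le> 1"
      using uv(3) y False by simp
    moreover have "(G $$ (v, u))\<^sup>2 = 1 / 2"
      using Guv G_sym[of u v] uv by simp
    ultimately have "(G $$ (u, y))\<^sup>2 \<le> 0"
      using Guv by linarith
    then show ?thesis by simp
  qed (use Gstar uv in simp)
  have G0: "G $$ (x, y) = 0" if "x < n" "y < n" "\<not> (x = u \<and> y = v \<or> x = v \<and> y = u)" for x y
    using that Gu[of x] Gu[of y] Gstar[of x y] G_sym[of x y] by metis
  have l0: "l x = 0" if "x < n" "x \<noteq> u" "x \<noteq> v" for x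
    using uv(5) l0 T that by auto
  define t :: real where "t = 1 / sqrt 2"
  have t: "t > 0" "t\<^sup>2 = 1 / 2" by (simp_all add: t_def power_divide)
  have lu: "l u = - l v" using uv(5) T by simp
  have "(\<Sum>x<n. (l x)\<^sup>2) = (\<Sum>x\<in>{u, v}. (l x)\<^sup>2)"
    using uv l0 by (intro sum.mono_neutral_right) auto
  then have "(l v)\<^sup>2 = t\<^sup>2" using l1 lu uv t by simp
  then have lt: "l v = t \<or> l v = - t" by (simp add: power2_eq_iff)
  have "(G $$ (u, v))\<^sup>2 = t\<^sup>2" using Guv t by simp
  then obtain e :: real where e: "e = 1 \<or> e = - 1" "G $$ (u, v) = e * t"
    unfolding power2_eq_iff by (metis mult_1 mult_minus1)
  have diag: "cong_mat P A $$ (x, y) = (if x = y then l x else 0)" if "x < n" "y < n" for x y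
    unfolding P(2) using that by (simp add: diag_real_def)
  have off: "cong_mat P (E c) $$ (x, y) = (if x = u \<and> y = v \<or> x = v \<and> y = u then e * t else 0)"
    if "x < n" "y < n" for x y
    unfolding G_def[symmetric] using G0[OF that] e(2) G_sym[of u v] uv by auto
  \<comment> \<open>The vertex with the positive eigenvalue has to come first, so the cases differ
    by exchanging \<open>u\<close> and \<open>v\<close>.\<close>
  from lt show ?thesis
    unfolding t_def[symmetric]
  proof
    assume "l v = - t"
    then show "\<exists>Q\<in>orthogonal_group n. cong_mat Q A = H1_real n t \<and> cong_mat Q (E c) = H2_real n t"
      using lu l0 by (intro normal_form_pair[OF P(1) A(1) Ec(1) uv(1-3) t(1) _ off e(1)])
        (auto simp: diag)
  next
    assume "l v = t"
    moreover have "cong_mat P (E c) $$ (x, y) = (if x = v \<and> y = u \<or> x = u \<and> y = v then e * t else 0)"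
      if "x < n" "y < n" for x y
      using off[OF that] by meson
    ultimately show "\<exists>Q\<in>orthogonal_group n. cong_mat Q A = H1_real n t \<and> cong_mat Q (E c) = H2_real n t"
      using lu l0 uv(3) by (intro normal_form_pair[OF P(1) A(1) Ec(1) uv(2,1) _ t(1) _ _ e(1)])
        (auto simp: diag)
  qed
qed

end

section \<open>Orthogonal families\<close>

lemma frob_cartesian: "frob n A B = (\<Sum>z\<in>{..<n} \<times> {..<n}. A $$ z * B $$ z)"
  by (simp add: frob_def sum.cartesian_product)

lemma frob_smult:
  "A \<in> carrier_mat n n \<Longrightarrow> B \<in> carrier_mat n n \<Longrightarrow> frob n (a \<cdot>\<^sub>m A) (b \<cdot>\<^sub>m B) = a * b * frob n A B"
  by (simp add: frob_def sum_distrib_left mult_ac)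

lemma mat_comm_smult:
  fixes A B :: "real mat"
  assumes "A \<in> carrier_mat n n" "B \<in> carrier_mat n n"
  shows "mat_comm (a \<cdot>\<^sub>m A) (b \<cdot>\<^sub>m B) = (a * b) \<cdot>\<^sub>m mat_comm A B"
proof (rule eq_matI)
  fix i j assume "i < dim_row ((a * b) \<cdot>\<^sub>m mat_comm A B)" "j < dim_col ((a * b) \<cdot>\<^sub>m mat_comm A B)"
  then have ij: "i < n" "j < n" using mat_comm_carrier[OF assms] by auto
  have "mat_comm (a \<cdot>\<^sub>m A) (b \<cdot>\<^sub>m B) $$ (i, j) =
      (\<Sum>k<n. (a \<cdot>\<^sub>m A) $$ (i, k) * (b \<cdot>\<^sub>m B) $$ (k, j) - (b \<cdot>\<^sub>m B) $$ (i, k) * (a \<cdot>\<^sub>m A) $$ (k, j))"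
    using assms ij by (intro mat_comm_index) auto
  also have "\<dots> = (\<Sum>k<n. (a * b) * (A $$ (i, k) * B $$ (k, j) - B $$ (i, k) * A $$ (k, j)))"
    using assms ij by (intro sum.cong refl) (simp add: algebra_simps)
  also have "\<dots> = ((a * b) \<cdot>\<^sub>m mat_comm A B) $$ (i, j)"
    using ij mat_comm_carrier[OF assms] by (simp add: mat_comm_index[OF assms ij] sum_distrib_left)
  finally show "mat_comm (a \<cdot>\<^sub>m A) (b \<cdot>\<^sub>m B) $$ (i, j) = ((a * b) \<cdot>\<^sub>m mat_comm A B) $$ (i, j)" .
qed (use assms in \<open>auto simp: mat_comm_def\<close>)

locale orthogonal_family =
  fixes n k :: nat and A :: "nat \<Rightarrow> real mat"
  assumes carrier: "i < k \<Longrightarrow> A i \<in> carrier_mat n n"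
    and symm: "i < k \<Longrightarrow> transpose_mat (A i) = A i"
    and orthogonal: "i < k \<Longrightarrow> j < k \<Longrightarrow> i \<noteq> j \<Longrightarrow> frob n (A i) (A j) = 0"
begin

text \<open>Despite the name this is the squared length, the variable of the quadratic form.\<close>

definition "len i = frob n (A i) (A i)"

definition "support = {i. i < k \<and> len i \<noteq> 0}"

text \<open>Since division by zero yields zero, this is the zero matrix outside
  \<open>support\<close>.\<close>

definition "unit i = (1 / sqrt (len i)) \<cdot>\<^sub>m A i"

definition "c i j = frob n (mat_comm (unit i) (unit j)) (mat_comm (unit i) (unit j))"

lemma finite_support: "finite support"
  by (simp add: support_def)

lemma support_less: "i \<in> support \<Longrightarrow> i < k"
  by (simp add: support_def)

lemma len_pos: "i \<in> support \<Longrightarrow> 0 < len i"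
  using frob_nonneg[of n "A i"] by (simp add: support_def len_def)

lemma unit_carrier: "i < k \<Longrightarrow> unit i \<in> carrier_mat n n"
  by (simp add: unit_def carrier)

lemma A_eq_smult_unit: "i \<in> support \<Longrightarrow> A i = sqrt (len i) \<cdot>\<^sub>m unit i"
  using len_pos[of i] by (auto simp: unit_def intro!: eq_matI)

lemma A_eq_0: "i < k \<Longrightarrow> i \<notin> support \<Longrightarrow> A i = 0\<^sub>m n n"
  using frob_eq_0_iff[OF carrier] by (simp add: support_def len_def)

lemma frame: "T \<subseteq> support \<Longrightarrow> orthonormal_frame n T unit"
proof
  assume T: "T \<subseteq> support"
  show "finite T" using T finite_support by (rule finite_subset)
  fix i assume i: "i \<in> T"
  then have ik: "i < k" using T support_less by auto
  show "unit i \<in> carrier_mat n n" by (rule unit_carrier[OF ik])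
  have "transpose_mat (unit i) = (1 / sqrt (len i)) \<cdot>\<^sub>m transpose_mat (A i)"
    unfolding unit_def by (auto intro!: eq_matI)
  then show "transpose_mat (unit i) = unit i" by (simp add: symm[OF ik] unit_def)
  fix j assume j: "j \<in> T"
  then have jk: "j < k" using T support_less by auto
  have "frob n (unit i) (unit j) = 1 / sqrt (len i) * (1 / sqrt (len j)) * frob n (A i) (A j)"
    unfolding unit_def by (rule frob_smult[OF carrier[OF ik] carrier[OF jk]])
  then show "frob n (unit i) (unit j) = (if i = j then 1 else 0)"
    using orthogonal[OF ik jk] len_pos[of i] i T by (auto simp: len_def[symmetric])
qed

lemma framed:
  assumes "T \<subseteq> support" "i \<in> T"
  shows "framed_matrix n (T - {i}) unit (unit i)"
proof -
  interpret F: orthonormal_frame n T unit by (rule frame[OF assms(1)])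
  interpret orthonormal_frame n "T - {i}" unit
    using assms by (intro frame) auto
  show ?thesis
    using assms(2) by unfold_locales (simp_all add: F.carrier F.symm F.orthonormal)
qed

lemma c_diag: "i < k \<Longrightarrow> c i i = 0"
  using unit_carrier[of i] by (simp add: c_def mat_comm_def frob_def)

lemma c_commute: "i < k \<Longrightarrow> j < k \<Longrightarrow> c i j = c j i"
  unfolding c_def by (intro frob_mat_comm_commute unit_carrier)

text \<open>A matrix commutes with itself, so the diagonal term is zero; the removed index accounts
  for the summand 1 in \<open>comm_frame_le\<close>.\<close>

lemma c_row_remove:
  assumes "T \<subseteq> support" "i \<in> T"
  shows "(\<Sum>j\<in>T. c i j) = (\<Sum>j\<in>T - {i}. c i j)" "real (card T) = real (card (T - {i})) + 1"
proof -
  have fin: "finite T" using finite_subset[OF assms(1) finite_support] .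
  show "(\<Sum>j\<in>T. c i j) = (\<Sum>j\<in>T - {i}. c i j)"
    using c_diag[of i] assms support_less[of i] by (simp add: sum.remove[OF fin assms(2)] subset_iff)
  show "real (card T) = real (card (T - {i})) + 1"
    using card.remove[OF fin assms(2)] by simp
qed

lemma c_row_le:
  assumes "T \<subseteq> support" "i \<in> T"
  shows "(\<Sum>j\<in>T. c i j) \<le> card T"
proof -
  interpret framed_matrix n "T - {i}" unit "unit i" by (rule framed[OF assms])
  show ?thesis
    using comm_frame_le c_row_remove[OF assms] by (simp add: c_def)
qed

lemma frob_comm_eq:
  assumes "i \<in> support" "j \<in> support"
  shows "frob n (mat_comm (A i) (A j)) (mat_comm (A i) (A j)) = len i * len j * c i j"
proof -
  note u = unit_carrier[OF support_less[OF assms(1)]] unit_carrier[OF support_less[OF assms(2)]]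
  have "mat_comm (A i) (A j) = (sqrt (len i) * sqrt (len j)) \<cdot>\<^sub>m mat_comm (unit i) (unit j)"
    using mat_comm_smult[OF u, of "sqrt (len i)" "sqrt (len j)"]
    by (simp add: A_eq_smult_unit[OF assms(1), symmetric] A_eq_smult_unit[OF assms(2), symmetric])
  moreover have "sqrt (len i) * sqrt (len j) * (sqrt (len i) * sqrt (len j)) = (sqrt (len i))\<^sup>2 * (sqrt (len j))\<^sup>2"
    by (simp only: power2_eq_square mult_ac)
  ultimately show ?thesis
    using len_pos[OF assms(1)] len_pos[OF assms(2)]
    by (simp add: frob_smult mat_comm_carrier[OF u] c_def)
qed

lemma sum_frob_eq: "(\<Sum>i<k. frob n (A i) (A i)) = (\<Sum>i\<in>support. len i)"
  unfolding len_def[symmetric]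
  by (rule sum.mono_neutral_right) (auto simp: support_def)

lemma sum_frob_comm_eq:
  "(\<Sum>i<k. \<Sum>j<k. frob n (mat_comm (A i) (A j)) (mat_comm (A i) (A j))) =
   (\<Sum>i\<in>support. \<Sum>j\<in>support. len i * len j * c i j)"
proof -
  have 0: "frob n (mat_comm (A i) (A j)) (mat_comm (A i) (A j)) = 0"
    if "i < k" "j < k" "i \<notin> support \<or> j \<notin> support" for i j
    using that(3) A_eq_0 that(1,2) carrier[of i] carrier[of j]
    by (auto simp: mat_comm_def frob_def)
  have sub: "support \<subseteq> {..<k}" by (auto simp: support_def)
  have "(\<Sum>i<k. \<Sum>j<k. frob n (mat_comm (A i) (A j)) (mat_comm (A i) (A j))) =
    (\<Sum>i\<in>support. \<Sum>j<k. frob n (mat_comm (A i) (A j)) (mat_comm (A i) (A j)))"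
    using 0 sub by (intro sum.mono_neutral_right) auto
  also have "\<dots> = (\<Sum>i\<in>support. \<Sum>j\<in>support. frob n (mat_comm (A i) (A j)) (mat_comm (A i) (A j)))"
    using 0 sub by (intro sum.cong refl sum.mono_neutral_right) auto
  finally show ?thesis by (simp add: frob_comm_eq)
qed

theorem comm_le:
  "(\<Sum>i<k. \<Sum>j<k. frob n (mat_comm (A i) (A j)) (mat_comm (A i) (A j))) \<le> (\<Sum>i<k. frob n (A i) (A i))\<^sup>2"
  unfolding sum_frob_eq sum_frob_comm_eq
  by (rule quad_form_le[OF finite_support])
    (auto simp: c_commute support_less c_row_le less_imp_le[OF len_pos])

text \<open>Equality makes every row of \<open>c\<close> tight on the support. The trace of the cube
  then rules out more than two nonzero members, and a single tight pair has a normal form.\<close>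

theorem comm_eq_imp_normal_form:
  assumes eq: "(\<Sum>i<k. \<Sum>j<k. frob n (mat_comm (A i) (A j)) (mat_comm (A i) (A j))) =
    (\<Sum>i<k. frob n (A i) (A i))\<^sup>2"
  shows "(\<forall>i<k. A i = 0\<^sub>m n n) \<or>
    (\<exists>a b t. \<exists>P\<in>orthogonal_group n. a < k \<and> b < k \<and> a \<noteq> b \<and> 0 \<le> t \<and>
      cong_mat P (A a) = H1_real n t \<and> cong_mat P (A b) = H2_real n t \<and>
      (\<forall>i<k. i \<noteq> a \<longrightarrow> i \<noteq> b \<longrightarrow> A i = 0\<^sub>m n n))"
proof (cases "support = {}")
  case True
  then show ?thesis using A_eq_0 by blast
next
  case False
  have row: "(\<Sum>j\<in>support. c i j) = card support" if "i \<in> support" for i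
    using eq[unfolded sum_frob_eq sum_frob_comm_eq]
    by (intro quad_form_eq_imp_row[OF finite_support _ _ len_pos _ that])
      (auto simp: c_commute support_less c_row_le)
  have row': "(\<Sum>j\<in>support - {i}. frob n (mat_comm (unit i) (unit j)) (mat_comm (unit i) (unit j))) =
      card (support - {i}) + 1" if "i \<in> support" for i
    using row[OF that] c_row_remove[OF subset_refl that] by (simp add: c_def)
  obtain a where a: "a \<in> support" using False by blast
  \<comment> \<open>A lone matrix would have an empty row sum where the row equation demands
    1.\<close>
  have "support - {a} \<noteq> {}"
  proof
    assume empty: "support - {a} = {}"
    show False using row'[OF a] unfolding empty by simp
  qed
  then obtain b where b: "b \<in> support" "b \<noteq> a" by blast
  interpret Fa: framed_matrix n "support - {a}" unit "unit a"
    by (rule framed[OF subset_refl a])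
  interpret Fb: framed_matrix n "support - {b}" unit "unit b"
    by (rule framed[OF subset_refl b(1)])
  \<comment> \<open>Otherwise row \<open>a\<close> gives \<open>unit a\<close> a nonzero trace of
    the cube, while row \<open>b\<close> counts \<open>unit a\<close> among the frame matrices,
    where that trace is zero.\<close>
  have "card (support - {a}) < 2"
  proof (rule ccontr)
    assume "\<not> card (support - {a}) < 2"
    then have "frob n (unit a * unit a) (unit a) \<noteq> 0"
      using Fa.comm_frame_eq_imp_cubes(1)[OF row'[OF a]] by simp
    moreover have "frob n (unit a * unit a) (unit a) = 0"
      using Fb.comm_frame_eq_imp_cubes(2)[OF row'[OF b(1)]] a b(2) by simp
    ultimately show False by simp
  qed
  moreover have "b \<in> support - {a}" using b by simp
  ultimately have sa: "support - {a} = {b}"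
    using finite_support by (metis card_1_singleton_iff card_gt_0_iff empty_iff finite_Diff
        less_2_cases less_irrefl singletonD)
  have sup: "support = {a, b}" using sa a by blast
  have cab: "c a b = 2" using row'[OF a] sa by (simp add: c_def)
  have ka: "a < k" and kb: "b < k" using a b support_less by auto
  \<comment> \<open>Both orders of the pair contribute \<open>2 * len a * len b\<close>, so equality
    forces equal lengths and one common scale \<open>t\<close>.\<close>
  have "(\<Sum>i\<in>support. \<Sum>j\<in>support. len i * len j * c i j) = 4 * len a * len b"
    using b(2) cab c_commute[OF ka kb] c_diag[OF ka] c_diag[OF kb] by (simp add: sup)
  moreover have "(\<Sum>i\<in>support. len i) = len a + len b" using b(2) by (simp add: sup)
  ultimately have "4 * len a * len b = (len a + len b)\<^sup>2"
    using eq[unfolded sum_frob_eq sum_frob_comm_eq] by simp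
  then have "(len a - len b)\<^sup>2 = 0" by (simp add: power2_eq_square algebra_simps)
  then have len: "len b = len a" by simp
  obtain P where P: "P \<in> orthogonal_group n" "cong_mat P (unit a) = H1_real n (1 / sqrt 2)"
    "cong_mat P (unit b) = H2_real n (1 / sqrt 2)"
    using Fa.comm_pair_eq_imp_normal_form[OF sa] cab unfolding c_def by blast
  note Pc = orthogonal_group_carrier[OF P(1)]
  define t where "t = sqrt (len a) * (1 / sqrt 2)"
  have "cong_mat P (s \<cdot>\<^sub>m X) = s \<cdot>\<^sub>m cong_mat P X" if "X \<in> carrier_mat n n" for s X
    using Pc that by (simp add: mult_smult_distrib[of _ n n _ n] mult_smult_assoc_mat[of _ n n _ n])
  then have "cong_mat P (A a) = sqrt (len a) \<cdot>\<^sub>m H1_real n (1 / sqrt 2)"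
    "cong_mat P (A b) = sqrt (len a) \<cdot>\<^sub>m H2_real n (1 / sqrt 2)"
    using A_eq_smult_unit[OF a] A_eq_smult_unit[OF b(1)] P(2,3) unit_carrier[OF ka] unit_carrier[OF kb]
    by (simp_all add: len)
  then have "cong_mat P (A a) = H1_real n t" "cong_mat P (A b) = H2_real n t"
    by (auto simp: t_def H1_real_def H2_real_def intro!: eq_matI)
  moreover have "0 \<le> t" using len_pos[OF a] by (simp add: t_def)
  ultimately show ?thesis
    using P(1) ka kb b(2) A_eq_0 sup by blast
qed

end

section \<open>The inequality for real symmetric matrices\<close>

text \<open>The action of the second factor of \<open>K\<close> alone; the new members are indexed
  by the columns of \<open>R\<close>.\<close>

definition rot :: "nat \<Rightarrow> nat \<Rightarrow> real mat \<Rightarrow> (nat \<Rightarrow> real mat) \<Rightarrow> nat \<Rightarrow> real mat" where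
  "rot n k R A l = mat n n (\<lambda>z. \<Sum>j<k. R $$ (j, l) * A j $$ z)"

lemma rot_carrier: "rot n k R A l \<in> carrier_mat n n"
  by (simp add: rot_def)

lemma rot_index: "z \<in> {..<n} \<times> {..<n} \<Longrightarrow> rot n k R A l $$ z = (\<Sum>j<k. R $$ (j, l) * A j $$ z)"
  by (auto simp: rot_def)

lemma rot_symm:
  assumes "\<And>j. j < k \<Longrightarrow> A j \<in> carrier_mat n n" "\<And>j. j < k \<Longrightarrow> transpose_mat (A j) = A j"
  shows "transpose_mat (rot n k R A l) = rot n k R A l"
  using symmetric_mat_index[OF assms] by (auto simp: rot_def intro!: eq_matI sum.cong)

text \<open>The Gram matrix of the family undergoes congruence by \<open>R\<close>, written in the
  shape of \<open>conj_index\<close>.\<close>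

lemma frob_rot:
  "frob n (rot n k R A l) (rot n k R A m) =
    (\<Sum>i<k. R $$ (i, l) * (\<Sum>j<k. R $$ (j, m) * frob n (A i) (A j)))"
proof -
  let ?X = "{..<n} \<times> {..<n}"
  have "frob n (rot n k R A l) (rot n k R A m) =
     (\<Sum>z\<in>?X. \<Sum>i<k. \<Sum>j<k. R $$ (i, l) * (R $$ (j, m) * (A i $$ z * A j $$ z)))"
    unfolding frob_cartesian by (intro sum.cong refl) (simp add: rot_index sum_product mult_ac)
  also have "\<dots> = (\<Sum>i<k. \<Sum>z\<in>?X. \<Sum>j<k. R $$ (i, l) * (R $$ (j, m) * (A i $$ z * A j $$ z)))"
    by (rule sum.swap)
  also have "\<dots> = (\<Sum>i<k. \<Sum>j<k. \<Sum>z\<in>?X. R $$ (i, l) * (R $$ (j, m) * (A i $$ z * A j $$ z)))"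
    by (intro sum.cong refl sum.swap)
  finally show ?thesis
    by (simp only: frob_cartesian sum_distrib_left)
qed

lemma sum_frob_rot:
  assumes "R \<in> orthogonal_group k"
  shows "(\<Sum>l<k. frob n (rot n k R A l) (rot n k R A l)) = (\<Sum>j<k. frob n (A j) (A j))"
proof -
  have "(\<Sum>l<k. frob n (rot n k R A l) (rot n k R A l)) =
    (\<Sum>z\<in>{..<n} \<times> {..<n}. \<Sum>l<k. rot n k R A l $$ z * rot n k R A l $$ z)"
    unfolding frob_cartesian by (rule sum.swap)
  also have "\<dots> = (\<Sum>z\<in>{..<n} \<times> {..<n}. \<Sum>j<k. A j $$ z * A j $$ z)"
    by (rule sum.cong[OF refl]) (simp only: rot_index orthogonal_group_parseval[OF assms])
  also have "\<dots> = (\<Sum>j<k. frob n (A j) (A j))"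
    unfolding frob_cartesian by (rule sum.swap)
  finally show ?thesis .
qed

lemma mat_comm_rot_index:
  assumes A: "\<And>j. j < k \<Longrightarrow> A j \<in> carrier_mat n n" and z: "z \<in> {..<n} \<times> {..<n}"
  shows "mat_comm (rot n k R A l) (rot n k R A m) $$ z =
    (\<Sum>i<k. R $$ (i, l) * (\<Sum>j<k. R $$ (j, m) * mat_comm (A i) (A j) $$ z))"
proof -
  obtain x y where xy: "z = (x, y)" "x < n" "y < n" using z by auto
  have "mat_comm (rot n k R A l) (rot n k R A m) $$ z =
      (\<Sum>q<n. rot n k R A l $$ (x, q) * rot n k R A m $$ (q, y) - rot n k R A m $$ (x, q) * rot n k R A l $$ (q, y))"
    unfolding xy(1) by (rule mat_comm_index[OF rot_carrier rot_carrier xy(2,3)])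
  also have "\<dots> = (\<Sum>q<n. \<Sum>i<k. \<Sum>j<k. R $$ (i, l) * (R $$ (j, m) *
      (A i $$ (x, q) * A j $$ (q, y) - A j $$ (x, q) * A i $$ (q, y))))"
  proof (intro sum.cong refl)
    fix q assume q: "q \<in> {..<n}"
    have "rot n k R A l $$ (x, q) * rot n k R A m $$ (q, y) =
        (\<Sum>i<k. \<Sum>j<k. (R $$ (i, l) * A i $$ (x, q)) * (R $$ (j, m) * A j $$ (q, y)))"
      using q xy by (simp add: rot_index sum_product)
    moreover have "rot n k R A m $$ (x, q) * rot n k R A l $$ (q, y) =
        (\<Sum>i<k. \<Sum>j<k. (R $$ (i, l) * A i $$ (q, y)) * (R $$ (j, m) * A j $$ (x, q)))"
      using q xy by (subst mult.commute) (simp add: rot_index sum_product)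
    ultimately show "rot n k R A l $$ (x, q) * rot n k R A m $$ (q, y) - rot n k R A m $$ (x, q) * rot n k R A l $$ (q, y) =
       (\<Sum>i<k. \<Sum>j<k. R $$ (i, l) * (R $$ (j, m) *
          (A i $$ (x, q) * A j $$ (q, y) - A j $$ (x, q) * A i $$ (q, y))))"
      by (simp only: sum_subtractf[symmetric]) (intro sum.cong refl, simp add: algebra_simps)
  qed
  also have "\<dots> = (\<Sum>i<k. \<Sum>q<n. \<Sum>j<k. R $$ (i, l) * (R $$ (j, m) *
      (A i $$ (x, q) * A j $$ (q, y) - A j $$ (x, q) * A i $$ (q, y))))"
    by (rule sum.swap)
  also have "\<dots> = (\<Sum>i<k. \<Sum>j<k. \<Sum>q<n. R $$ (i, l) * (R $$ (j, m) *
      (A i $$ (x, q) * A j $$ (q, y) - A j $$ (x, q) * A i $$ (q, y))))"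
    by (intro sum.cong refl sum.swap)
  also have "\<dots> = (\<Sum>i<k. R $$ (i, l) * (\<Sum>j<k. R $$ (j, m) * mat_comm (A i) (A j) $$ z))"
    unfolding sum_distrib_left xy(1)
    by (intro sum.cong refl) (simp only: mat_comm_index[OF A A xy(2,3)] lessThan_iff sum_distrib_left)
  finally show ?thesis .
qed

text \<open>By bilinearity \<open>R\<close> acts on both indices of the array of commutators;
  Parseval's identity removes it first from one index, then from the other.\<close>

lemma sum_frob_comm_rot:
  assumes R: "R \<in> orthogonal_group k" and A: "\<And>j. j < k \<Longrightarrow> A j \<in> carrier_mat n n"
  shows "(\<Sum>l<k. \<Sum>m<k. frob n (mat_comm (rot n k R A l) (rot n k R A m)) (mat_comm (rot n k R A l) (rot n k R A m))) =
    (\<Sum>i<k. \<Sum>j<k. frob n (mat_comm (A i) (A j)) (mat_comm (A i) (A j)))"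
proof -
  let ?X = "{..<n} \<times> {..<n}"
  define C where "C i j z = mat_comm (A i) (A j) $$ z" for i j z
  define D where "D i m z = (\<Sum>j<k. R $$ (j, m) * C i j z)" for i m z
  have "(\<Sum>l<k. \<Sum>m<k. frob n (mat_comm (rot n k R A l) (rot n k R A m)) (mat_comm (rot n k R A l) (rot n k R A m))) =
     (\<Sum>l<k. \<Sum>m<k. \<Sum>z\<in>?X. (\<Sum>i<k. R $$ (i, l) * D i m z) * (\<Sum>i<k. R $$ (i, l) * D i m z))"
    unfolding frob_cartesian D_def C_def
    by (intro sum.cong refl) (simp only: mat_comm_rot_index[OF A])
  also have "\<dots> = (\<Sum>m<k. \<Sum>l<k. \<Sum>z\<in>?X. (\<Sum>i<k. R $$ (i, l) * D i m z) * (\<Sum>i<k. R $$ (i, l) * D i m z))"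
    by (rule sum.swap)
  also have "\<dots> = (\<Sum>m<k. \<Sum>z\<in>?X. \<Sum>l<k. (\<Sum>i<k. R $$ (i, l) * D i m z) * (\<Sum>i<k. R $$ (i, l) * D i m z))"
    by (intro sum.cong refl sum.swap)
  also have "\<dots> = (\<Sum>m<k. \<Sum>z\<in>?X. \<Sum>i<k. D i m z * D i m z)"
    by (simp only: orthogonal_group_parseval[OF R])
  also have "\<dots> = (\<Sum>m<k. \<Sum>i<k. \<Sum>z\<in>?X. D i m z * D i m z)"
    by (intro sum.cong refl sum.swap)
  also have "\<dots> = (\<Sum>i<k. \<Sum>m<k. \<Sum>z\<in>?X. D i m z * D i m z)"
    by (rule sum.swap)
  also have "\<dots> = (\<Sum>i<k. \<Sum>z\<in>?X. \<Sum>m<k. D i m z * D i m z)"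
    by (intro sum.cong refl sum.swap)
  also have "\<dots> = (\<Sum>i<k. \<Sum>z\<in>?X. \<Sum>j<k. C i j z * C i j z)"
    by (simp only: D_def orthogonal_group_parseval[OF R])
  also have "\<dots> = (\<Sum>i<k. \<Sum>j<k. \<Sum>z\<in>?X. C i j z * C i j z)"
    by (intro sum.cong refl sum.swap)
  finally show ?thesis
    by (simp only: frob_cartesian C_def)
qed

section \<open>Reduction to orthogonal families and the equality case\<close>

lemma ex_orthogonal_rot:
  assumes A: "\<And>j. j < k \<Longrightarrow> A j \<in> carrier_mat n n" "\<And>j. j < k \<Longrightarrow> transpose_mat (A j) = A j"
  shows "\<exists>R\<in>orthogonal_group k. orthogonal_family n k (rot n k R A)"
proof -
  \<comment> \<open>Diagonalising this Gram matrix is the same as making the rotated family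
    orthogonal.\<close>
  define G where "G = mat k k (\<lambda>(i, j). frob n (A i) (A j))"
  have G: "G \<in> carrier_mat k k" "transpose_mat G = G"
    by (auto simp: G_def frob_commute intro!: eq_matI)
  obtain R d where R: "R \<in> orthogonal_group k"
    and d: "cong_mat R G = mat k k (\<lambda>(i, j). if i = j then d i else 0)"
    using real_spectral[OF G] by blast
  have "frob n (rot n k R A i) (rot n k R A j) = 0" if ij: "i < k" "j < k" "i \<noteq> j" for i j
  proof -
    have "frob n (rot n k R A i) (rot n k R A j) = cong_mat R G $$ (i, j)"
      unfolding frob_rot conj_index[OF orthogonal_group_carrier[OF R] G(1) ij(1,2)]
      by (intro sum.cong refl) (simp add: G_def)
    then show ?thesis using ij by (simp add: d)
  qed
  then show ?thesis
    using R by (intro bexI[of _ R]) (unfold_locales, auto simp: rot_carrier rot_symm A)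
qed

text \<open>Both sides are invariant under rotation of the family, which reduces the claim to
  orthogonal families.\<close>

theorem real_ddvv_le:
  fixes k n :: nat and A :: "nat \<Rightarrow> real mat"
  assumes A: "\<And>j. j < k \<Longrightarrow> A j \<in> carrier_mat n n" "\<And>j. j < k \<Longrightarrow> transpose_mat (A j) = A j"
  shows "(\<Sum>i<k. \<Sum>j<k. frob n (mat_comm (A i) (A j)) (mat_comm (A i) (A j))) \<le> (\<Sum>i<k. frob n (A i) (A i))\<^sup>2"
proof -
  have "\<exists>R\<in>orthogonal_group k. orthogonal_family n k (rot n k R A)"
    by (rule ex_orthogonal_rot) (simp_all add: A)
  then obtain R where R: "R \<in> orthogonal_group k" "orthogonal_family n k (rot n k R A)" by blast
  show ?thesis
    using orthogonal_family.comm_le[OF R(2)]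
    by (simp only: sum_frob_rot[OF R(1)] sum_frob_comm_rot[OF R(1)] A(1))
qed

text \<open>The normal form in real terms. Congruence is applied after mixing here, whereas
  \<open>K_act\<close> conjugates first; \<open>cong_mat_rot_index\<close> reconciles the two
  orders.\<close>

definition ddvv_form :: "nat \<Rightarrow> nat \<Rightarrow> real mat \<Rightarrow> real mat \<Rightarrow> (nat \<Rightarrow> real mat) \<Rightarrow> real \<Rightarrow> bool" where
  "ddvv_form n k P R A t \<longleftrightarrow> (\<forall>l<k. cong_mat P (rot n k R A l) =
     (if l = 0 then H1_real n t else if l = 1 then H2_real n t else 0\<^sub>m n n))"

theorem real_ddvv_eq_imp_form:
  fixes k n :: nat and A :: "nat \<Rightarrow> real mat"
  assumes A: "\<And>j. j < k \<Longrightarrow> A j \<in> carrier_mat n n" "\<And>j. j < k \<Longrightarrow> transpose_mat (A j) = A j"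
    and eq: "(\<Sum>i<k. \<Sum>j<k. frob n (mat_comm (A i) (A j)) (mat_comm (A i) (A j))) = (\<Sum>i<k. frob n (A i) (A i))\<^sup>2"
  shows "\<exists>P\<in>orthogonal_group n. \<exists>R\<in>orthogonal_group k. \<exists>t\<ge>0. ddvv_form n k P R A t"
proof -
  have "\<exists>R\<in>orthogonal_group k. orthogonal_family n k (rot n k R A)"
    by (rule ex_orthogonal_rot) (simp_all add: A)
  then obtain R where R: "R \<in> orthogonal_group k" "orthogonal_family n k (rot n k R A)" by blast
  interpret orthogonal_family n k "rot n k R A" by (rule R(2))
  have "(\<Sum>i<k. \<Sum>j<k. frob n (mat_comm (rot n k R A i) (rot n k R A j)) (mat_comm (rot n k R A i) (rot n k R A j))) =
    (\<Sum>i<k. frob n (rot n k R A i) (rot n k R A i))\<^sup>2"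
    using eq by (simp only: sum_frob_rot[OF R(1)] sum_frob_comm_rot[OF R(1)] A(1))
  from comm_eq_imp_normal_form[OF this] show ?thesis
  proof
    \<comment> \<open>The zero family has the normal form with \<open>t = 0\<close>.\<close>
    assume 0: "\<forall>i<k. rot n k R A i = 0\<^sub>m n n"
    have "ddvv_form n k (1\<^sub>m n) R A 0"
      unfolding ddvv_form_def using 0 by (auto simp: H1_real_def H2_real_def intro!: eq_matI)
    then show ?thesis using R(1) one_mem_orthogonal_group by blast
  next
    assume "\<exists>a b t. \<exists>P\<in>orthogonal_group n. a < k \<and> b < k \<and> a \<noteq> b \<and> 0 \<le> t \<and>
      cong_mat P (rot n k R A a) = H1_real n t \<and> cong_mat P (rot n k R A b) = H2_real n t \<and>
      (\<forall>i<k. i \<noteq> a \<longrightarrow> i \<noteq> b \<longrightarrow> rot n k R A i = 0\<^sub>m n n)"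
    then obtain a b t P where P: "P \<in> orthogonal_group n" and ab: "a < k" "b < k" "a \<noteq> b" and t: "0 \<le> t"
      and Pa: "cong_mat P (rot n k R A a) = H1_real n t" and Pb: "cong_mat P (rot n k R A b) = H2_real n t"
      and rest: "\<forall>i<k. i \<noteq> a \<longrightarrow> i \<noteq> b \<longrightarrow> rot n k R A i = 0\<^sub>m n n"
      by blast
    \<comment> \<open>Permuting the columns of \<open>R\<close> moves the two surviving members to
      positions 0 and 1.\<close>
    obtain p where p: "p permutes {..<k}" "p 0 = a" "p 1 = b"
      by (rule ex_permutes_two[OF ab])
    define S where "S = mat k k (\<lambda>(x, i). R $$ (x, p i))"
    have S: "S \<in> orthogonal_group k"
      using signed_permutation_of_cols(1)[OF R(1) p(1), of "\<lambda>_. 1"] by (simp add: S_def)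
    have rotS: "rot n k S A l = rot n k R A (p l)" if "l < k" for l
      using that by (auto simp: rot_def S_def intro!: eq_matI sum.cong)
    have "ddvv_form n k P S A t"
      unfolding ddvv_form_def
    proof (intro allI impI)
      fix l assume l: "l < k"
      have pl: "p l < k" using permutes_in_image[OF p(1), of l] l by simp
      have "p l = a \<longleftrightarrow> l = 0" "p l = b \<longleftrightarrow> l = 1"
        using permutes_inj[OF p(1)] p(2,3) by (metis injD)+
      moreover have "cong_mat P (0\<^sub>m n n) = 0\<^sub>m n n"
        using orthogonal_group_carrier[OF P] by simp
      ultimately show "cong_mat P (rot n k S A l) =
          (if l = 0 then H1_real n t else if l = 1 then H2_real n t else 0\<^sub>m n n)"
        unfolding rotS[OF l] using Pa Pb p(2,3) rest pl by auto
    qed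
    then show ?thesis using P S t by blast
  qed
qed

lemma frob_H1_real: "n \<ge> 2 \<Longrightarrow> frob n (H1_real n t) (H1_real n t) = 2 * t\<^sup>2"
  and frob_H2_real: "n \<ge> 2 \<Longrightarrow> frob n (H2_real n t) (H2_real n t) = 2 * t\<^sup>2"
  and frob_comm_H1_H2_real: "n \<ge> 2 \<Longrightarrow>
    frob n (mat_comm (H1_real n t) (H2_real n t)) (mat_comm (H1_real n t) (H2_real n t)) = 8 * t ^ 4"
proof -
  assume n: "n \<ge> 2"
  have two: "(\<Sum>i<n. f i) = f 0 + f 1" if "\<And>i. i < n \<Longrightarrow> i \<ge> 2 \<Longrightarrow> f i = 0" for f :: "nat \<Rightarrow> real"
  proof -
    have "(\<Sum>i<n. f i) = (\<Sum>i\<in>{0, 1}. f i)"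
      using n that by (intro sum.mono_neutral_right) auto
    then show ?thesis by simp
  qed
  have H: "H1_real n t \<in> carrier_mat n n" "H2_real n t \<in> carrier_mat n n"
    by (simp_all add: H1_real_def H2_real_def)
  have f: "frob n X X = (X $$ (0, 0))\<^sup>2 + (X $$ (0, 1))\<^sup>2 + ((X $$ (1, 0))\<^sup>2 + (X $$ (1, 1))\<^sup>2)"
    if "\<And>i j. i < n \<Longrightarrow> j < n \<Longrightarrow> i \<ge> 2 \<or> j \<ge> 2 \<Longrightarrow> X $$ (i, j) = 0" for X
    unfolding frob_def using that n by (simp add: two power2_eq_square)
  show "frob n (H1_real n t) (H1_real n t) = 2 * t\<^sup>2" "frob n (H2_real n t) (H2_real n t) = 2 * t\<^sup>2"
    using n by (subst f; auto simp: H1_real_def H2_real_def)+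
  have comm: "mat_comm (H1_real n t) (H2_real n t) $$ (i, j) =
      (if i = 0 \<and> j = 1 then 2 * t\<^sup>2 else if i = 1 \<and> j = 0 then - 2 * t\<^sup>2 else 0)"
    if ij: "i < n" "j < n" for i j
  proof -
    have "mat_comm (H1_real n t) (H2_real n t) $$ (i, j) =
      H1_real n t $$ (i, 0) * H2_real n t $$ (0, j) - H2_real n t $$ (i, 0) * H1_real n t $$ (0, j) +
      (H1_real n t $$ (i, 1) * H2_real n t $$ (1, j) - H2_real n t $$ (i, 1) * H1_real n t $$ (1, j))"
      unfolding mat_comm_index[OF H ij] using n ij
      by (intro two) (auto simp: H1_real_def H2_real_def)
    then show ?thesis
      using n ij by (auto simp: H1_real_def H2_real_def power2_eq_square)
  qed
  show "frob n (mat_comm (H1_real n t) (H2_real n t)) (mat_comm (H1_real n t) (H2_real n t)) = 8 * t ^ 4"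
    using n by (subst f) (auto simp: comm power2_eq_square numeral_eq_Suc)
qed

text \<open>By invariance only the normal form has to be evaluated: the squared norms sum to
  \<open>4 * t\<^sup>2\<close>, and the two ordered commutators contribute \<open>8 * t ^ 4\<close>
  each.\<close>

theorem real_ddvv_form_imp_eq:
  assumes A: "\<And>j. j < k \<Longrightarrow> A j \<in> carrier_mat n n"
    and n: "n \<ge> 2" and k: "k \<ge> 2" and P: "P \<in> orthogonal_group n" and R: "R \<in> orthogonal_group k"
    and form: "ddvv_form n k P R A t"
  shows "(\<Sum>i<k. \<Sum>j<k. frob n (mat_comm (A i) (A j)) (mat_comm (A i) (A j))) = (\<Sum>i<k. frob n (A i) (A i))\<^sup>2"
proof -
  define C where "C l = cong_mat P (rot n k R A l)" for l
  have C: "C l = (if l = 0 then H1_real n t else if l = 1 then H2_real n t else 0\<^sub>m n n)" if "l < k" for l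
    using form that by (simp add: ddvv_form_def C_def)
  have H: "H1_real n t \<in> carrier_mat n n" "H2_real n t \<in> carrier_mat n n"
    by (simp_all add: H1_real_def H2_real_def)
  have two: "(\<Sum>i<k. f i) = f 0 + f 1" if "\<And>i. i < k \<Longrightarrow> i \<noteq> 0 \<Longrightarrow> i \<noteq> 1 \<Longrightarrow> f i = 0" for f :: "nat \<Rightarrow> real"
  proof -
    have "(\<Sum>i<k. f i) = (\<Sum>i\<in>{0, 1}. f i)"
      using k that by (intro sum.mono_neutral_right) auto
    then show ?thesis by simp
  qed
  have "(\<Sum>i<k. frob n (A i) (A i)) = (\<Sum>i<k. frob n (C i) (C i))"
    unfolding C_def frob_cong_mat[OF P rot_carrier rot_carrier] sum_frob_rot[OF R] ..
  also have "\<dots> = 4 * t\<^sup>2"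
    using k n by (subst two) (simp_all add: C frob_H1_real frob_H2_real frob_def[of n "0\<^sub>m n n"])
  finally have 1: "(\<Sum>i<k. frob n (A i) (A i)) = 4 * t\<^sup>2" .
  have 0: "frob n (mat_comm (C i) (C j)) (mat_comm (C i) (C j)) = 0"
    if "i < k" "j < k" "i = j \<or> i \<notin> {0, 1} \<or> j \<notin> {0, 1}" for i j
  proof -
    have "mat_comm (C i) (C j) = 0\<^sub>m n n"
      using that H C[of i] C[of j] by (auto simp: mat_comm_def)
    then show ?thesis by (simp add: frob_def)
  qed
  have "(\<Sum>i<k. \<Sum>j<k. frob n (mat_comm (A i) (A j)) (mat_comm (A i) (A j))) =
      (\<Sum>i<k. \<Sum>j<k. frob n (mat_comm (C i) (C j)) (mat_comm (C i) (C j)))"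
    unfolding C_def frob_mat_comm_cong_mat[OF P rot_carrier rot_carrier]
    by (simp only: sum_frob_comm_rot[OF R] A)
  also have "\<dots> = frob n (mat_comm (C 0) (C 1)) (mat_comm (C 0) (C 1)) +
      frob n (mat_comm (C 1) (C 0)) (mat_comm (C 1) (C 0))"
    using k 0 by (simp add: two)
  also have "\<dots> = 16 * t ^ 4"
    using k n by (simp add: C frob_comm_H1_H2_real frob_mat_comm_commute[OF H(2,1)])
  finally show ?thesis
    unfolding 1 by (simp add: power2_eq_square numeral_eq_Suc)
qed

section \<open>Reduction of the complex symmetric case\<close>

lemma sum_swap4:
  fixes F :: "nat \<Rightarrow> nat \<Rightarrow> nat \<Rightarrow> nat \<Rightarrow> real"
  shows "(\<Sum>x<n. \<Sum>y<n. \<Sum>z<n. \<Sum>w<n. F x y z w) = (\<Sum>x<n. \<Sum>y<n. \<Sum>z<n. \<Sum>w<n. F z w x y)"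
proof -
  have "(\<Sum>x<n. \<Sum>y<n. \<Sum>z<n. \<Sum>w<n. F x y z w) = (\<Sum>x<n. \<Sum>z<n. \<Sum>y<n. \<Sum>w<n. F x y z w)"
    by (intro sum.cong refl sum.swap)
  also have "\<dots> = (\<Sum>z<n. \<Sum>x<n. \<Sum>y<n. \<Sum>w<n. F x y z w)"
    by (rule sum.swap)
  also have "\<dots> = (\<Sum>z<n. \<Sum>x<n. \<Sum>w<n. \<Sum>y<n. F x y z w)"
    by (intro sum.cong refl sum.swap)
  also have "\<dots> = (\<Sum>z<n. \<Sum>w<n. \<Sum>x<n. \<Sum>y<n. F x y z w)"
    by (intro sum.cong refl sum.swap)
  finally show ?thesis .
qed

text \<open>Both sides are the trace of \<open>a * b * d * c\<close>, read in opposite directions.\<close>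

lemma frob_mult_exchange:
  assumes c: "a \<in> carrier_mat n n" "b \<in> carrier_mat n n" "c \<in> carrier_mat n n" "d \<in> carrier_mat n n"
    and sym: "transpose_mat a = a" "transpose_mat d = d"
  shows "frob n (a * b) (c * d) = frob n (a * c) (b * d)"
proof -
  have e: "frob n (a * b) (c * d) =
      (\<Sum>x<n. \<Sum>y<n. \<Sum>z<n. \<Sum>w<n. (a $$ (x, z) * b $$ (z, y)) * (c $$ (x, w) * d $$ (w, y)))"
    if "b \<in> carrier_mat n n" "c \<in> carrier_mat n n" for b c
    unfolding frob_def using assms(1,4) that
    by (intro sum.cong refl) (simp add: scalar_prod_def lessThan_atLeast0 sum_product)
  show ?thesis
    unfolding e[OF c(2,3)] e[OF c(3,2)]
    by (subst (2) sum_swap4)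
      (intro sum.cong refl, simp add: symmetric_mat_index[OF c(1) sym(1)] symmetric_mat_index[OF c(4) sym(2)] mult_ac)
qed

text \<open>Transposition preserves the inner product and reverses products of symmetric
  matrices.\<close>

lemma frob_mult_transpose:
  assumes c: "a \<in> carrier_mat n n" "b \<in> carrier_mat n n" "c \<in> carrier_mat n n" "d \<in> carrier_mat n n"
    and sym: "transpose_mat a = a" "transpose_mat b = b" "transpose_mat c = c" "transpose_mat d = d"
  shows "frob n (b * a) (d * c) = frob n (a * b) (c * d)"
proof -
  have t: "(y * x) $$ (i, j) = (x * y) $$ (j, i)"
    if "x \<in> carrier_mat n n" "y \<in> carrier_mat n n" "transpose_mat x = x" "transpose_mat y = y" "i < n" "j < n"
    for x y :: "real mat" and i j
  proof -
    have "transpose_mat (x * y) = y * x"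
      using transpose_mult[OF that(1,2)] that(3,4) by simp
    moreover have "transpose_mat (x * y) $$ (i, j) = (x * y) $$ (j, i)"
      using that by (intro index_transpose_mat) auto
    ultimately show ?thesis by simp
  qed
  have "frob n (b * a) (d * c) = (\<Sum>i<n. \<Sum>j<n. (a * b) $$ (j, i) * (c * d) $$ (j, i))"
    unfolding frob_def
    by (intro sum.cong refl) (simp only: lessThan_iff t[OF c(1,2) sym(1,2)] t[OF c(3,4) sym(3,4)])
  also have "\<dots> = frob n (a * b) (c * d)"
    unfolding frob_def by (rule sum.swap)
  finally show ?thesis .
qed

text \<open>Of the four products, transposition identifies two pairs.\<close>

lemma frob_comm_comm:
  assumes c: "a \<in> carrier_mat n n" "b \<in> carrier_mat n n" "c \<in> carrier_mat n n" "d \<in> carrier_mat n n"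
    and sym: "transpose_mat a = a" "transpose_mat b = b" "transpose_mat c = c" "transpose_mat d = d"
  shows "frob n (mat_comm a b) (mat_comm c d) = 2 * frob n (a * b) (c * d) - 2 * frob n (a * b) (d * c)"
proof -
  have "frob n (mat_comm a b) (mat_comm c d) =
    frob n (a * b) (c * d) - frob n (a * b) (d * c) - frob n (b * a) (c * d) + frob n (b * a) (d * c)"
    unfolding frob_def sum.distrib[symmetric] sum_subtractf[symmetric]
    using c by (intro sum.cong refl) (simp add: mat_comm_def algebra_simps del: index_mult_mat(1))
  then show ?thesis
    using frob_mult_transpose[OF c sym] frob_mult_transpose[OF c(1,2,4,3) sym(1,2,4,3)] by simp
qed

text \<open>The Jacobi identity in trace form: after expansion, \<open>frob_mult_exchange\<close>
  cancels two of the four terms on the left and matches the others with the right.\<close>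

lemma frob_comm_jacobi:
  assumes c: "a \<in> carrier_mat n n" "b \<in> carrier_mat n n" "c \<in> carrier_mat n n" "d \<in> carrier_mat n n"
    and sym: "transpose_mat a = a" "transpose_mat b = b" "transpose_mat c = c" "transpose_mat d = d"
  shows "frob n (mat_comm a b) (mat_comm c d) - frob n (mat_comm a d) (mat_comm c b) =
    frob n (mat_comm a c) (mat_comm b d)"
  unfolding frob_comm_comm[OF c sym] frob_comm_comm[OF c(1,4,3,2) sym(1,4,3,2)]
    frob_comm_comm[OF c(1,3,2,4) sym(1,3,2,4)]
  using frob_mult_exchange[OF c sym(1,4)] frob_mult_exchange[OF c(1,2,4,3) sym(1,3)]
    frob_mult_exchange[OF c(1,4,3,2) sym(1,2)]
  by simp

lemma complex_commutator_index:
  fixes X Y :: "complex mat"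
  assumes c: "X \<in> carrier_mat n n" "Y \<in> carrier_mat n n" and ij: "i < n" "j < n"
  shows "commutator X Y $$ (i, j) =
    Complex (mat_comm (map_mat Re X) (map_mat Re Y) $$ (i, j) - mat_comm (map_mat Im X) (map_mat Im Y) $$ (i, j))
      (mat_comm (map_mat Re X) (map_mat Im Y) $$ (i, j) + mat_comm (map_mat Im X) (map_mat Re Y) $$ (i, j))"
proof -
  have r: "map_mat f X \<in> carrier_mat n n" "map_mat f Y \<in> carrier_mat n n" for f :: "complex \<Rightarrow> real"
    using c by simp_all
  have "commutator X Y $$ (i, j) = (\<Sum>k<n. X $$ (i, k) * Y $$ (k, j) - Y $$ (i, k) * X $$ (k, j))"
    using c ij by (simp add: commutator_def scalar_prod_def lessThan_atLeast0 sum_subtractf)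
  then show ?thesis
    unfolding mat_comm_index[OF r(1) r(2) ij] using c ij
    by (simp add: complex_eq_iff sum.distrib[symmetric] sum_subtractf[symmetric] algebra_simps)
qed

lemma frobenius_sq_Re_Im:
  assumes X: "X \<in> carrier_mat n n"
  shows "frobenius_sq X = frob n (map_mat Re X) (map_mat Re X) + frob n (map_mat Im X) (map_mat Im X)"
  unfolding frobenius_sq_trace(2) frob_def using X
  by (simp add: cmod_power2 sum.distrib flip: power2_eq_square)

text \<open>The squared real and imaginary parts give four norms and two mixed terms. The Jacobi
  identity merges the mixed terms into a product of a term in \<open>X\<close> and a term in
  \<open>Y\<close>, which sums over all pairs to a squared norm.\<close>

lemma frobenius_sq_commutator:
  fixes X Y :: "complex mat"
  assumes c: "X \<in> carrier_mat n n" "Y \<in> carrier_mat n n" and sym: "transpose_mat X = X" "transpose_mat Y = Y"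
  defines "X1 \<equiv> map_mat Re X" and "X2 \<equiv> map_mat Im X" and "Y1 \<equiv> map_mat Re Y" and "Y2 \<equiv> map_mat Im Y"
  shows "frobenius_sq (commutator X Y) =
    frob n (mat_comm X1 Y1) (mat_comm X1 Y1) + frob n (mat_comm X1 Y2) (mat_comm X1 Y2)
    + frob n (mat_comm X2 Y1) (mat_comm X2 Y1) + frob n (mat_comm X2 Y2) (mat_comm X2 Y2)
    - 2 * frob n (mat_comm X1 X2) (mat_comm Y1 Y2)"
proof -
  have r: "X1 \<in> carrier_mat n n" "Y1 \<in> carrier_mat n n" "X2 \<in> carrier_mat n n" "Y2 \<in> carrier_mat n n"
    using c by (simp_all add: X1_def X2_def Y1_def Y2_def)
  have "transpose_mat (map_mat f Z) = map_mat f Z" if "transpose_mat Z = Z" for f :: "complex \<Rightarrow> real" and Z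
    using that by (simp add: map_mat_transpose)
  then have s: "transpose_mat X1 = X1" "transpose_mat Y1 = Y1" "transpose_mat X2 = X2" "transpose_mat Y2 = Y2"
    using sym by (simp_all add: X1_def X2_def Y1_def Y2_def)
  have C: "commutator X Y \<in> carrier_mat n n" using c by (auto simp: commutator_def)
  have "frobenius_sq (commutator X Y) =
    frob n (mat_comm X1 Y1) (mat_comm X1 Y1) + frob n (mat_comm X1 Y2) (mat_comm X1 Y2)
    + frob n (mat_comm X2 Y1) (mat_comm X2 Y1) + frob n (mat_comm X2 Y2) (mat_comm X2 Y2)
    - 2 * (frob n (mat_comm X1 Y1) (mat_comm X2 Y2) - frob n (mat_comm X1 Y2) (mat_comm X2 Y1))"
    unfolding frobenius_sq_Re_Im[OF C] frob_def sum.distrib[symmetric] sum_subtractf[symmetric] sum_distrib_left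
    using C
    by (intro sum.cong refl)
      (simp add: complex_commutator_index[OF c] X1_def X2_def Y1_def Y2_def algebra_simps)
  then show ?thesis
    unfolding frob_comm_jacobi[OF r s] .
qed

section \<open>From the complex group action to real families\<close>

lemma sum_lessThan_add:
  fixes f :: "nat \<Rightarrow> 'a :: comm_monoid_add"
  shows "(\<Sum>j<m + p. f j) = (\<Sum>j<m. f j) + (\<Sum>j<p. f (m + j))"
  by (induction p) (simp_all add: ac_simps)

lemma cong_mat_rot_index:
  assumes P: "P \<in> carrier_mat n n" and A: "\<And>j. j < k \<Longrightarrow> A j \<in> carrier_mat n n" and xy: "x < n" "y < n"
  shows "cong_mat P (rot n k R A l) $$ (x, y) = (\<Sum>j<k. R $$ (j, l) * cong_mat P (A j) $$ (x, y))"
proof -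
  have "cong_mat P (rot n k R A l) $$ (x, y) =
      (\<Sum>a<n. \<Sum>b<n. \<Sum>j<k. R $$ (j, l) * (P $$ (a, x) * (P $$ (b, y) * A j $$ (a, b))))"
    unfolding conj_index[OF P rot_carrier xy] sum_distrib_left
    by (intro sum.cong refl) (simp add: rot_index sum_distrib_left mult_ac)
  also have "\<dots> = (\<Sum>a<n. \<Sum>j<k. \<Sum>b<n. R $$ (j, l) * (P $$ (a, x) * (P $$ (b, y) * A j $$ (a, b))))"
    by (intro sum.cong refl sum.swap)
  also have "\<dots> = (\<Sum>j<k. \<Sum>a<n. \<Sum>b<n. R $$ (j, l) * (P $$ (a, x) * (P $$ (b, y) * A j $$ (a, b))))"
    by (rule sum.swap)
  also have "\<dots> = (\<Sum>j<k. R $$ (j, l) * cong_mat P (A j) $$ (x, y))"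
  proof (rule sum.cong[OF refl])
    fix j assume "j \<in> {..<k}"
    then have "A j \<in> carrier_mat n n" using A by simp
    then show "(\<Sum>a<n. \<Sum>b<n. R $$ (j, l) * (P $$ (a, x) * (P $$ (b, y) * A j $$ (a, b)))) =
        R $$ (j, l) * cong_mat P (A j) $$ (x, y)"
      by (simp only: conj_index[OF P _ xy] sum_distrib_left)
  qed
  finally show ?thesis .
qed

lemma map_mat_of_real_eq_iff:
  "map_mat complex_of_real X = map_mat complex_of_real Y \<longleftrightarrow> X = Y"
proof
  assume eq: "map_mat complex_of_real X = map_mat complex_of_real Y"
  have dim: "dim_row X = dim_row Y" "dim_col X = dim_col Y"
    using arg_cong[OF eq, of dim_row] arg_cong[OF eq, of dim_col] by simp_all
  show "X = Y"
  proof (rule eq_matI)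
    fix i j assume "i < dim_row Y" "j < dim_col Y"
    then show "X $$ (i, j) = Y $$ (i, j)"
      using arg_cong[OF eq, of "\<lambda>M. M $$ (i, j)"] dim by simp
  qed (use dim in simp_all)
qed simp

lemma map_mat_cong_mat:
  assumes "P \<in> carrier_mat n n" "X \<in> carrier_mat n n"
  shows "mat_adjoint (map_mat complex_of_real P) * map_mat complex_of_real X * map_mat complex_of_real P =
    map_mat complex_of_real (cong_mat P X)"
proof -
  have "mat_adjoint (map_mat complex_of_real P) = map_mat complex_of_real (transpose_mat P)"
    unfolding mat_adjoint_eq by (rule eq_matI) auto
  then show ?thesis
    using assms by (simp add: of_real_hom.mat_hom_mult[of _ n n _ n] mult_carrier_mat[of _ n n _ n])
qed

lemma diag_zero_H1: "n \<ge> 2 \<Longrightarrow> diag_zero n (H1 t) = map_mat complex_of_real (H1_real n t)"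
  and diag_zero_H2: "n \<ge> 2 \<Longrightarrow> diag_zero n (H2 t) = map_mat complex_of_real (H2_real n t)"
  by (auto intro!: eq_matI simp: diag_zero_def H1_def H2_def H1_real_def H2_real_def mat_of_rows_list_def
      Let_def less_2_cases_iff nth_Cons')

lemma mat_Re_eq: "mat_Re X = map_mat complex_of_real (map_mat Re X)"
  by (auto intro!: eq_matI simp: mat_Re_def complex_eq_iff)

lemma mat_Im_eq: "mat_Im X = map_mat complex_of_real (map_mat Im X)"
  by (auto intro!: eq_matI simp: mat_Im_def complex_eq_iff)

lemma map_mat_of_real_mem_unitary_group:
  assumes "P \<in> orthogonal_group n"
  shows "map_mat complex_of_real P \<in> unitary_group n"
proof -
  note P = orthogonal_group_carrier[OF assms]
  have "mat_adjoint (map_mat complex_of_real P) = map_mat complex_of_real (transpose_mat P)"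
    unfolding mat_adjoint_eq by (rule eq_matI) auto
  moreover have "map_mat complex_of_real (transpose_mat P) * map_mat complex_of_real P =
      map_mat complex_of_real (transpose_mat P * P)"
    using P by (simp add: of_real_hom.mat_hom_mult[of _ n n _ n])
  ultimately show ?thesis
    using P by (auto simp: unitary_group_def orthogonal_group_transpose_mult[OF assms] intro!: eq_matI)
qed

text \<open>The order of the list in the theorem: all real parts, then the imaginary parts shifted
  by \<open>m\<close>.\<close>

definition re_im :: "nat \<Rightarrow> (nat \<Rightarrow> complex mat) \<Rightarrow> nat \<Rightarrow> real mat" where
  "re_im m B j = (if j < m then map_mat Re (B j) else map_mat Im (B (j - m)))"

lemma re_im_simps: "r < m \<Longrightarrow> re_im m B r = map_mat Re (B r)" "re_im m B (m + r) = map_mat Im (B r)"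
  by (simp_all add: re_im_def)

text \<open>For real \<open>P\<close> the adjoint is the transpose, so both lists consist of
  embedded real matrices and can be compared entry by entry through the injective embedding.\<close>

lemma K_act_eq_iff_ddvv_form:
  assumes n: "n \<ge> 2" and m: "m \<ge> 1" and B: "\<And>r. r < m \<Longrightarrow> B r \<in> carrier_mat n n"
    and P: "P \<in> orthogonal_group n"
  shows "K_act (map_mat complex_of_real P, R)
      (map (\<lambda>r. mat_Re (B r)) [0..<m] @ map (\<lambda>r. mat_Im (B r)) [0..<m]) =
      [diag_zero n (H1 t), diag_zero n (H2 t)] @ replicate (2 * m - 2) (0\<^sub>m n n)
    \<longleftrightarrow> ddvv_form n (2 * m) P R (re_im m B) t"
proof -
  let ?As = "map (\<lambda>r. mat_Re (B r)) [0..<m] @ map (\<lambda>r. mat_Im (B r)) [0..<m]"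
  let ?H = "\<lambda>l. if l = 0 then H1_real n t else if l = 1 then H2_real n t else 0\<^sub>m n n"
  let ?rhs = "[diag_zero n (H1 t), diag_zero n (H2 t)] @ replicate (2 * m - 2) (0\<^sub>m n n)"
  note Pc = orthogonal_group_carrier[OF P]
  have A: "re_im m B j \<in> carrier_mat n n" if "j < 2 * m" for j
    using that B[of j] B[of "j - m"] by (auto simp: re_im_def)
  have As: "?As ! j = map_mat complex_of_real (re_im m B j)" if "j < 2 * m" for j
    using that by (auto simp: nth_append re_im_def mat_Re_eq mat_Im_eq)
  have lhs: "K_act (map_mat complex_of_real P, R) ?As ! l =
      map_mat complex_of_real (cong_mat P (rot n (2 * m) R (re_im m B) l))" (is "?L = ?M")
    if l: "l < 2 * m" for l
  proof -
    define f where "f j = complex_of_real (R $$ (j, l)) \<cdot>\<^sub>m map_mat complex_of_real (cong_mat P (re_im m B j))" for j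
    have fc: "f j \<in> carrier_mat n n" if "j < 2 * m" for j
      unfolding f_def using cong_mat_carrier[OF Pc A[OF that]] by simp
    have "?L = finsum_mat n (\<lambda>j. complex_of_real (R $$ (j, l)) \<cdot>\<^sub>m
       (mat_adjoint (map_mat complex_of_real P) * ?As ! j * map_mat complex_of_real P)) {..<2 * m}"
      using l Pc by (simp add: K_act_def mult_2)
    \<comment> \<open>The summands are known to agree, and to lie in the carrier, only within the
      index range.\<close>
    also have "\<dots> = finsum_mat n f {..<2 * m}"
    proof -
      interpret M: abelian_group "module_mat TYPE(complex) n n"
        by (rule abelian_group_mat)
      show ?thesis
        unfolding finsum_mat_def
        by (intro M.finsum_cong')
          (auto simp: f_def As map_mat_cong_mat[OF Pc A] module_mat_simps cong_mat_carrier[OF Pc A]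
            simp del: index_mult_mat)
    qed
    also have "\<dots> = mat n n (\<lambda>(i, j). \<Sum>s<2 * m. f s $$ (i, j))"
      using fc by (intro finsum_mat_index) auto
    also have "\<dots> = ?M"
    proof (rule eq_matI)
      fix x y assume "x < dim_row ?M" "y < dim_col ?M"
      then have xy: "x < n" "y < n" by (simp_all add: carrier_matD[OF Pc])
      have "(\<Sum>s<2 * m. f s $$ (x, y)) =
          (\<Sum>s<2 * m. complex_of_real (R $$ (s, l) * cong_mat P (re_im m B s) $$ (x, y)))"
      proof (rule sum.cong[OF refl])
        fix s assume "s \<in> {..<2 * m}"
        then have "cong_mat P (re_im m B s) \<in> carrier_mat n n"
          using cong_mat_carrier[OF Pc A] by simp
        then show "f s $$ (x, y) = complex_of_real (R $$ (s, l) * cong_mat P (re_im m B s) $$ (x, y))"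
          using xy unfolding f_def by (simp del: index_mult_mat)
      qed
      also have "\<dots> = complex_of_real (cong_mat P (rot n (2 * m) R (re_im m B) l) $$ (x, y))"
        by (subst cong_mat_rot_index[OF Pc _ xy]) (simp_all add: A del: index_mult_mat)
      finally show "mat n n (\<lambda>(i, j). \<Sum>s<2 * m. f s $$ (i, j)) $$ (x, y) = ?M $$ (x, y)"
        using xy by (simp add: carrier_matD[OF Pc] del: index_mult_mat(1))
    qed (use Pc in \<open>simp_all add: rot_def\<close>)
    finally show ?thesis .
  qed
  have rhs: "?rhs ! l = map_mat complex_of_real (?H l)" if "l < 2 * m" for l
    using that n
    by (auto simp: diag_zero_H1 diag_zero_H2 nth_Cons' nth_append intro!: eq_matI)
  \<comment> \<open>\<open>m \<ge> 1\<close> keeps the subtraction in \<open>2 * m - 2\<close> from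
    being truncated.\<close>
  have len: "length (K_act (map_mat complex_of_real P, R) ?As) = 2 * m" "length ?rhs = 2 * m"
    using m by (simp_all add: K_act_def)
  have "K_act (map_mat complex_of_real P, R) ?As = ?rhs \<longleftrightarrow>
      (\<forall>l<2 * m. K_act (map_mat complex_of_real P, R) ?As ! l = ?rhs ! l)"
    unfolding list_eq_iff_nth_eq len by blast
  also have "\<dots> \<longleftrightarrow> (\<forall>l<2 * m. map_mat complex_of_real (cong_mat P (rot n (2 * m) R (re_im m B) l)) =
      map_mat complex_of_real (?H l))"
    using lhs rhs by (metis (lifting))
  finally show ?thesis
    unfolding map_mat_of_real_eq_iff ddvv_form_def .
qed

theorem corollary2p5:
  fixes n m :: nat and B :: "nat \<Rightarrow> complex mat"
  assumes "n \<ge> 2" and "m \<ge> 1"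
    and "\<And>r. r < m \<Longrightarrow> B r \<in> carrier_mat n n"
    and "\<And>r. r < m \<Longrightarrow> transpose_mat (B r) = B r"
  shows
    "(\<Sum>r<m. \<Sum>s<m. frobenius_sq (commutator (B r) (B s))) \<le> (\<Sum>r<m. frobenius_sq (B r))\<^sup>2 \<and>
     ((\<Sum>r<m. \<Sum>s<m. frobenius_sq (commutator (B r) (B s))) = (\<Sum>r<m. frobenius_sq (B r))\<^sup>2 \<longleftrightarrow>
       finsum_mat n (\<lambda>r. commutator (B r) (mat_cnj (B r))) {..<m} = 0\<^sub>m n n \<and>
       (\<exists>P R. \<exists>t\<ge>0. (P, R) \<in> K n (2 * m) \<and>
         P \<in> map_mat complex_of_real ` orthogonal_group n \<and>
         K_act (P, R) (map (\<lambda>r. mat_Re (B r)) [0..<m] @ map (\<lambda>r. mat_Im (B r)) [0..<m]) =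
           [diag_zero n (H1 t), diag_zero n (H2 t)] @ replicate (2 * m - 2) (0\<^sub>m n n)))"
proof -
  define A where "A = re_im m B"
  define C where "C r = mat_comm (map_mat Re (B r)) (map_mat Im (B r))" for r
  \<comment> \<open>The sum of the commutators of real and imaginary parts; its squared norm is the
    gap between the real and the complex problem.\<close>
  define S where "S = mat n n (\<lambda>z. \<Sum>r<m. C r $$ z)"
  define L where "L = (\<Sum>i<2 * m. \<Sum>j<2 * m. frob n (mat_comm (A i) (A j)) (mat_comm (A i) (A j)))"
  define N where "N = (\<Sum>r<m. frobenius_sq (B r))"
  have carr: "A j \<in> carrier_mat n n" "transpose_mat (A j) = A j" if "j < 2 * m" for j
    using that assms(3,4)[of j] assms(3,4)[of "j - m"] by (auto simp: A_def re_im_def map_mat_transpose)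
  have Cc: "C r \<in> carrier_mat n n" if "r < m" for r
    unfolding C_def using assms(3)[OF that] by (intro mat_comm_carrier) auto
  have Sc: "S \<in> carrier_mat n n" by (simp add: S_def)
  have split: "(\<Sum>j<2 * m. f j) = (\<Sum>r<m. f r) + (\<Sum>r<m. f (m + r))" for f :: "nat \<Rightarrow> real"
    unfolding mult_2 by (rule sum_lessThan_add)
  have N: "N = (\<Sum>j<2 * m. frob n (A j) (A j))"
    unfolding N_def split sum.distrib[symmetric]
    by (intro sum.cong refl) (simp add: A_def re_im_simps frobenius_sq_Re_Im[OF assms(3)])
  have FS: "frob n S S = (\<Sum>r<m. \<Sum>s<m. frob n (C r) (C s))"
  proof -
    let ?X = "{..<n} \<times> {..<n}"
    have "frob n S S = (\<Sum>z\<in>?X. \<Sum>r<m. \<Sum>s<m. C r $$ z * C s $$ z)"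
      unfolding frob_cartesian by (intro sum.cong refl) (auto simp: S_def sum_product)
    also have "\<dots> = (\<Sum>r<m. \<Sum>z\<in>?X. \<Sum>s<m. C r $$ z * C s $$ z)"
      by (rule sum.swap)
    also have "\<dots> = (\<Sum>r<m. \<Sum>s<m. \<Sum>z\<in>?X. C r $$ z * C s $$ z)"
      by (intro sum.cong refl sum.swap)
    finally show ?thesis by (simp only: frob_cartesian)
  qed
  \<comment> \<open>The four norms per pair fill the four blocks of \<open>L\<close>, and the
    correction terms add up to twice the squared norm of \<open>S\<close>.\<close>
  have lhs: "(\<Sum>r<m. \<Sum>s<m. frobenius_sq (commutator (B r) (B s))) = L - 2 * frob n S S"
    unfolding L_def FS split sum.distrib[symmetric] sum_subtractf[symmetric] sum_distrib_left
  proof (intro sum.cong refl)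
    fix r s assume "r \<in> {..<m}" "s \<in> {..<m}"
    then have rs: "r < m" "s < m" by simp_all
    show "frobenius_sq (commutator (B r) (B s)) =
      frob n (mat_comm (A r) (A s)) (mat_comm (A r) (A s)) +
      frob n (mat_comm (A r) (A (m + s))) (mat_comm (A r) (A (m + s))) +
      (frob n (mat_comm (A (m + r)) (A s)) (mat_comm (A (m + r)) (A s)) +
       frob n (mat_comm (A (m + r)) (A (m + s))) (mat_comm (A (m + r)) (A (m + s)))) -
      2 * frob n (C r) (C s)"
      using frobenius_sq_commutator[OF assms(3)[OF rs(1)] assms(3)[OF rs(2)] assms(4)[OF rs(1)] assms(4)[OF rs(2)]] rs
      by (simp add: A_def re_im_simps C_def)
  qed
  \<comment> \<open>The commutator of \<open>B r\<close> with its conjugate is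
    \<open>- 2 * \<i>\<close> times the commutator \<open>C r\<close> of its real and imaginary
    parts.\<close>
  have "frob n S S = 0 \<longleftrightarrow> finsum_mat n (\<lambda>r. commutator (B r) (mat_cnj (B r))) {..<m} = 0\<^sub>m n n"
  proof -
    have Bc: "mat_cnj (B r) \<in> carrier_mat n n" "commutator (B r) (mat_cnj (B r)) \<in> carrier_mat n n" if "r < m" for r
      using assms(3)[OF that] by (auto simp: commutator_def)
    have comm: "commutator (B r) (mat_cnj (B r)) $$ (i, j) = - 2 * \<i> * complex_of_real (C r $$ (i, j))"
      if "r < m" "i < n" "j < n" for r i j
    proof -
      have rc: "map_mat Re (B r) \<in> carrier_mat n n" "map_mat Im (B r) \<in> carrier_mat n n"
        using assms(3)[OF that(1)] by simp_all
      have cnj: "map_mat Re (mat_cnj (B r)) = map_mat Re (B r)"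
        "map_mat Im (mat_cnj (B r)) = (- 1) \<cdot>\<^sub>m map_mat Im (B r)"
        by (auto intro!: eq_matI)
      have one: "1 \<cdot>\<^sub>m M = M" for M :: "real mat"
        by (auto intro!: eq_matI)
      have "mat_comm (map_mat Re (B r)) ((- 1) \<cdot>\<^sub>m map_mat Im (B r)) $$ (i, j) = - C r $$ (i, j)"
        using mat_comm_smult[OF rc, of 1 "- 1"] Cc[OF that(1)] that(2,3) rc by (simp add: C_def one)
      moreover have "mat_comm (map_mat Im (B r)) (map_mat Re (B r)) $$ (i, j) = - C r $$ (i, j)"
        using rc that(2,3) by (simp add: C_def mat_comm_def del: index_mult_mat(1))
      moreover have "mat_comm (map_mat Im (B r)) ((- 1) \<cdot>\<^sub>m map_mat Im (B r)) $$ (i, j) = 0"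
        using mat_comm_smult[OF rc(2) rc(2), of 1 "- 1"] rc(2) that(2,3)
        by (simp add: one mat_comm_def[of "map_mat Im (B r)" "map_mat Im (B r)"] del: index_mult_mat(1))
      moreover have "mat_comm (map_mat Re (B r)) (map_mat Re (B r)) $$ (i, j) = 0"
        using rc(1) that(2,3) by (simp add: mat_comm_def del: index_mult_mat(1))
      ultimately show ?thesis
        unfolding complex_commutator_index[OF assms(3)[OF that(1)] Bc(1)[OF that(1)] that(2,3)] cnj
        by (simp add: complex_eq_iff)
    qed
    have fin: "finsum_mat n (\<lambda>r. commutator (B r) (mat_cnj (B r))) {..<m} =
        mat n n (\<lambda>(i, j). \<Sum>r<m. commutator (B r) (mat_cnj (B r)) $$ (i, j))"
      using Bc(2) by (intro finsum_mat_index) auto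
    have entry: "(\<Sum>r<m. commutator (B r) (mat_cnj (B r)) $$ (i, j)) = - 2 * \<i> * complex_of_real (S $$ (i, j))"
      if "i < n" "j < n" for i j
      using that comm by (simp add: S_def sum_distrib_left)
    have "finsum_mat n (\<lambda>r. commutator (B r) (mat_cnj (B r))) {..<m} =
        (- 2 * \<i>) \<cdot>\<^sub>m map_mat complex_of_real S"
      unfolding fin using entry Sc by (auto intro!: eq_matI)
    moreover have "(- 2 * \<i>) \<cdot>\<^sub>m map_mat complex_of_real S = 0\<^sub>m n n \<longleftrightarrow> S = 0\<^sub>m n n"
    proof
      assume z: "(- 2 * \<i>) \<cdot>\<^sub>m map_mat complex_of_real S = 0\<^sub>m n n"
      show "S = 0\<^sub>m n n"
      proof (rule eq_matI)
        fix i j assume "i < dim_row (0\<^sub>m n n :: real mat)" "j < dim_col (0\<^sub>m n n :: real mat)"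
        then show "S $$ (i, j) = 0\<^sub>m n n $$ (i, j)"
          using arg_cong[OF z, of "\<lambda>M. M $$ (i, j)"] Sc by simp
      qed (use Sc in simp_all)
    qed auto
    ultimately show ?thesis using frob_eq_0_iff[OF Sc] by simp
  qed
  moreover have "L = N\<^sup>2 \<longleftrightarrow> (\<exists>P R. \<exists>t\<ge>0. (P, R) \<in> K n (2 * m) \<and>
         P \<in> map_mat complex_of_real ` orthogonal_group n \<and>
         K_act (P, R) (map (\<lambda>r. mat_Re (B r)) [0..<m] @ map (\<lambda>r. mat_Im (B r)) [0..<m]) =
           [diag_zero n (H1 t), diag_zero n (H2 t)] @ replicate (2 * m - 2) (0\<^sub>m n n))"
    (is "_ \<longleftrightarrow> ?form")
  proof
    assume "L = N\<^sup>2"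
    then have "\<exists>P\<in>orthogonal_group n. \<exists>R\<in>orthogonal_group (2 * m). \<exists>t\<ge>0. ddvv_form n (2 * m) P R A t"
      unfolding L_def N by (intro real_ddvv_eq_imp_form carr)
    then obtain P R t where P: "P \<in> orthogonal_group n" and R: "R \<in> orthogonal_group (2 * m)"
      and t: "t \<ge> 0" and form: "ddvv_form n (2 * m) P R A t"
      by blast
    have "(map_mat complex_of_real P, R) \<in> K n (2 * m)"
      using R map_mat_of_real_mem_unitary_group[OF P] by (simp add: K_def)
    moreover note K_act_eq_iff_ddvv_form[OF assms(1-3) P, THEN iffD2, OF _ form[unfolded A_def]]
    ultimately show ?form
      using P t by blast
  next
    assume ?form
    then obtain P R t where P: "P \<in> orthogonal_group n" and K: "(map_mat complex_of_real P, R) \<in> K n (2 * m)"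
      and act: "K_act (map_mat complex_of_real P, R)
        (map (\<lambda>r. mat_Re (B r)) [0..<m] @ map (\<lambda>r. mat_Im (B r)) [0..<m]) =
           [diag_zero n (H1 t), diag_zero n (H2 t)] @ replicate (2 * m - 2) (0\<^sub>m n n)"
      by blast
    have R: "R \<in> orthogonal_group (2 * m)" using K by (simp add: K_def)
    have "ddvv_form n (2 * m) P R A t"
      unfolding A_def using act K_act_eq_iff_ddvv_form[of n m B P R t] assms(1-3) P by blast
    then show "L = N\<^sup>2"
      unfolding L_def N using assms(1,2) P R carr(1)
      by (intro real_ddvv_form_imp_eq[of "2 * m" A n P R t]) auto
  qed
  moreover have "L \<le> N\<^sup>2"
    unfolding L_def N by (intro real_ddvv_le carr)
  moreover have "0 \<le> frob n S S" by (rule frob_nonneg)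
  \<comment> \<open>The complex sum is \<open>L\<close> minus a nonnegative term, and
    \<open>L\<close> is at most \<open>N\<^sup>2\<close>; equality therefore means that both
    estimates are tight.\<close>
  ultimately show ?thesis
    unfolding lhs N_def[symmetric] by (smt (verit))
qed

end
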